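(* Let $X_1,X_2,\dots$ be i.i.d. non-negative random variables with bounded density $f$ and distribution function $F$. Let $m=m_n$ be integers with $1\le m\le n$ such that, as $n\to\infty$, $m\to\infty$, $\frac{m}{\log n}\to\infty$ and $\frac{m}{n}\to 0$. Then for $0<t_1<t_2<\infty$ with $F(t_1)<F(t_2)$, $$|IV_{mn}(t_1,t_2)-IV(t_1,t_2)|\to 0\quad\text{almost surely as } n\to\infty.$$
   Context: For $F(t_1)<F(t_2)$ the interval varextropy is $$IV(t_1,t_2)=\frac{1}{4(F(t_2)-F(t_1))^3}\int_{t_1}^{t_2} f(x)^3\,dx-\frac{1}{4(F(t_2)-F(t_1))^4}\Big(\int_{t_1}^{t_2} f(x)^2\,dx\Big)^2.$$ Let $X_{1:n}\le X_{2:n}\le\dots\le X_{n:n}$ be the ordered sample of $X_1,\dots,X_n$, and $F_n(x)=\frac1n\sum_{i=1}^n I(X_i\le x)$ the empirical distribution function, where $I(\cdot)$ is the indicator. The estimator is $$IV_{mn}(t_1,t_2)=\frac{1}{4(F_n(t_2)-F_n(t_1))^3}\,T_{mn}-\frac{1}{4(F_n(t_2)-F_n(t_1))^4}\,T'_{mn},$$ with $$T_{mn}=\frac{1}{2(n-m)}\sum_{j=1}^{n-m}\Big[\frac{m}{n+1}(X_{j+m:n}-X_{j:n})^{-1}\Big]^2\Big(I(t_1\le X_{j:n}\le t_2)+I(t_1\le X_{j+m:n}\le t_2)\Big),$$ $$T'_{mn}=\Big[\frac{1}{2(n-m)}\sum_{j=1}^{n-m}\frac{m}{n+1}(X_{j+m:n}-X_{j:n})^{-1}\Big(I(t_1\le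 X_{j:n}\le t_2)+I(t_1\le X_{j+m:n}\le t_2)\Big)\Big]^2.$$ *)

theory Defs
  imports "HOL-Probability.Probability"
begin

text \<open>
  An observed sample of size \<open>n\<close> is given by the first \<open>n\<close> terms \<open>x 0, \<dots>, x (n - 1)\<close> of a real
  sequence \<open>x\<close>, so \<open>x i\<close> stands for the observation usually written with index \<open>i + 1\<close>.
  Ranks are counted from 1: \<open>order_stat x n 1\<close> is the minimum and \<open>order_stat x n n\<close>
  the maximum. Ranks outside \<open>{1..n}\<close> are never used below.
\<close>

definition order_stat :: "(nat \<Rightarrow> real) \<Rightarrow> nat \<Rightarrow> nat \<Rightarrow> real" where
  "order_stat x n j = sort (map x [0..<n]) ! (j - 1)"

definition emp_cdf :: "(nat \<Rightarrow> real) \<Rightarrow> nat \<Rightarrow> real \<Rightarrow> real" where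
  "emp_cdf x n t = (1 / real n) * (\<Sum>i<n. indicator {..t} (x i))"

definition interval_varextropy :: "(real \<Rightarrow> real) \<Rightarrow> (real \<Rightarrow> real) \<Rightarrow> real \<Rightarrow> real \<Rightarrow> real" where
  "interval_varextropy f F t1 t2 =
     1 / (4 * (F t2 - F t1) ^ 3) * (LBINT x:{t1..t2}. f x ^ 3)
     - 1 / (4 * (F t2 - F t1) ^ 4) * (LBINT x:{t1..t2}. f x ^ 2) ^ 2"

definition spacing_density :: "(nat \<Rightarrow> real) \<Rightarrow> nat \<Rightarrow> nat \<Rightarrow> nat \<Rightarrow> real" where
  "spacing_density x n m j =
     real m / (real n + 1) * inverse (order_stat x n (j + m) - order_stat x n j)"

definition T_est :: "(nat \<Rightarrow> real) \<Rightarrow> nat \<Rightarrow> nat \<Rightarrow> real \<Rightarrow> real \<Rightarrow> real" where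
  "T_est x n m t1 t2 =
     1 / (2 * (real n - real m)) *
     (\<Sum>j=1..n - m. (spacing_density x n m j)\<^sup>2 *
        (indicator {t1..t2} (order_stat x n j) + indicator {t1..t2} (order_stat x n (j + m))))"

definition T'_est :: "(nat \<Rightarrow> real) \<Rightarrow> nat \<Rightarrow> nat \<Rightarrow> real \<Rightarrow> real \<Rightarrow> real" where
  "T'_est x n m t1 t2 =
     (1 / (2 * (real n - real m)) *
      (\<Sum>j=1..n - m. spacing_density x n m j *
        (indicator {t1..t2} (order_stat x n j) + indicator {t1..t2} (order_stat x n (j + m)))))\<^sup>2"

definition IV_est :: "(nat \<Rightarrow> real) \<Rightarrow> nat \<Rightarrow> nat \<Rightarrow> real \<Rightarrow> real \<Rightarrow> real" where
  "IV_est x n m t1 t2 =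
     1 / (4 * (emp_cdf x n t2 - emp_cdf x n t1) ^ 3) * T_est x n m t1 t2
     - 1 / (4 * (emp_cdf x n t2 - emp_cdf x n t1) ^ 4) * T'_est x n m t1 t2"

end

theory Submission
  imports Defs
begin

text \<open>
  Chernoff bounds on the cells of the grid of \<open>n\<close>-quantiles, together with the Borel--Cantelli
  lemma, show that almost surely, for every \<open>\<epsilon> > 0\<close> and all large \<open>n\<close>, every interval of mass \<open>p\<close>
  contains \<open>n p\<close> observations up to an error \<open>\<epsilon> (m + n p)\<close>; this uses \<open>m / log n \<longrightarrow> \<infinity>\<close>.
  Hence every \<open>m\<close>-spacing has mass \<open>(1 + o(1)) m / n\<close>, uniformly in the rank. So an average over
  the ranks \<open>j\<close> of terms \<open>a\<^sub>j\<close> is asymptotically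
  \<open>(1 / m) \<Sum>\<^sub>j a\<^sub>j (F (X\<^bsub>j+m:n\<^esub>) - F (X\<^bsub>j:n\<^esub>)) = \<integral> f z h\<^sub>n(z) dz\<close>, where \<open>h\<^sub>n(z)\<close> is the average of \<open>a\<^sub>j\<close> over
  the \<open>m\<close> ranks whose spacing contains \<open>z\<close>. At almost every \<open>z\<close> with \<open>f z > 0\<close>, those spacings
  shrink to \<open>z\<close>, and Lebesgue differentiation gives the limit of \<open>h\<^sub>n(z)\<close>. The spacing
  densities are bounded because \<open>f\<close> is, so dominated convergence yields the limit of the average.
\<close>

subsection \<open>Uniform control of interval counts\<close>

definition sample_count :: "(nat \<Rightarrow> real) \<Rightarrow> nat \<Rightarrow> real set \<Rightarrow> real" where
  "sample_count x n A = (\<Sum>i<n. indicator A (x i))"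

lemma sample_count_mono: "A \<subseteq> B \<Longrightarrow> sample_count x n A \<le> sample_count x n B"
  unfolding sample_count_def by (intro sum_mono) (auto split: split_indicator)

lemma sample_count_nonneg: "0 \<le> sample_count x n A"
  unfolding sample_count_def by (intro sum_nonneg) auto

lemma sample_count_eq_card: "sample_count x n A = real (card {i. i < n \<and> x i \<in> A})"
proof -
  have "{i \<in> {..<n}. x i \<in> A} = {i. i < n \<and> x i \<in> A}" by auto
  then show ?thesis
    unfolding sample_count_def indicator_def by (simp add: sum.If_cases Int_def)
qed

text \<open>This form makes the Chernoff exponents cancel at \<open>s = \<epsilon>\<close> and
  \<open>s = - \<epsilon>\<close> alike. For \<open>s < 0\<close> the Taylor lower bound for
  \<open>exp (- s)\<close> is inverted: its product with \<open>1 + s + s\<^sup>2\<close> is at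
  least 1.\<close>

lemma exp_le_quadratic:
  fixes s :: real
  assumes "\<bar>s\<bar> \<le> 1"
  shows "exp s \<le> 1 + s + s\<^sup>2"
proof (cases "0 \<le> s")
  case True
  then show ?thesis using exp_bound[of s] assms by simp
next
  case False
  have "1 - s + s\<^sup>2 / 2 \<le> exp (- s)"
    using exp_lower_Taylor_quadratic[of "- s"] False by simp
  then have "exp s * (1 - s + s\<^sup>2 / 2) \<le> 1"
    by (metis exp_ge_zero exp_minus_inverse mult_left_mono)
  moreover have "1 \<le> (1 + s + s\<^sup>2) * (1 - s + s\<^sup>2 / 2)"
  proof -
    have "(1 + s + s\<^sup>2) * (1 - s + s\<^sup>2 / 2) = 1 + s\<^sup>2 * (1 + s\<^sup>2 - s) / 2"
      by (simp add: field_simps power2_eq_square)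
    moreover have "0 \<le> 1 + s\<^sup>2 - s" using False zero_le_power2[of s] by linarith
    then have "0 \<le> s\<^sup>2 * (1 + s\<^sup>2 - s)" by simp
    ultimately show ?thesis by simp
  qed
  ultimately have "exp s * (1 - s + s\<^sup>2 / 2) \<le> (1 + s + s\<^sup>2) * (1 - s + s\<^sup>2 / 2)" by linarith
  moreover have "0 < 1 - s + s\<^sup>2 / 2" using False zero_le_power2[of s] by linarith
  ultimately show ?thesis by simp
qed

section \<open>Chernoff bounds for the number of observations in a fixed set\<close>

context prob_space
begin

text \<open>By independence the expectation factors over the observations, each factor being
  \<open>1 + (exp s - 1) * p\<close>, which is at most \<open>exp ((exp s - 1) * p)\<close>.\<close>

lemma mgf_sample_count:
  fixes X :: "nat \<Rightarrow> 'a \<Rightarrow> real" and p s :: real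
  assumes indep: "indep_vars (\<lambda>_. borel) X UNIV" and A: "A \<in> sets borel"
    and p: "\<And>i. prob (X i -` A \<inter> space M) = p"
  shows "integrable M (\<lambda>\<omega>. exp (s * sample_count (\<lambda>i. X i \<omega>) n A))" (is ?int)
    and "expectation (\<lambda>\<omega>. exp (s * sample_count (\<lambda>i. X i \<omega>) n A)) \<le> exp (real n * p * (exp s - 1))" (is ?le)
proof -
  have rv [measurable]: "X i \<in> borel_measurable M" for i
    using indep by (simp add: indep_vars_def)
  note A [measurable]
  \<comment> \<open>An indicator takes only the values 0 and 1, so its exponential is an affine
    function of it and the mean follows from linearity.\<close>
  define g where "g = (\<lambda>y::real. 1 + (exp s - 1) * indicator A y)"
  have [measurable]: "g \<in> borel_measurable borel" unfolding g_def by measurable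
  have prod: "exp (s * sample_count (\<lambda>i. X i \<omega>) n A) = (\<Prod>i\<in>{..<n}. g (X i \<omega>))" for \<omega>
    unfolding sample_count_def sum_distrib_left exp_sum[OF finite_lessThan]
    by (intro prod.cong) (auto simp: g_def split: split_indicator)
  have ind: "indep_vars (\<lambda>_. borel) (\<lambda>i \<omega>. g (X i \<omega>)) {..<n}"
    by (rule indep_vars_compose2[OF indep_vars_subset[OF indep]]) auto
  have int: "integrable M (\<lambda>\<omega>. g (X i \<omega>))" for i
    unfolding g_def
    by (intro integrable_const_bound[where B = "1 + \<bar>exp s - 1\<bar>"] AE_I2)
       (auto split: split_indicator)
  have E: "expectation (\<lambda>\<omega>. g (X i \<omega>)) = 1 + (exp s - 1) * p" for i
  proof -
    have "expectation (\<lambda>\<omega>. indicat_real A (X i \<omega>)) = expectation (indicator (X i -` A))"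
      by (intro Bochner_Integration.integral_cong) (auto split: split_indicator)
    also have "\<dots> = p" using p[of i] by simp
    finally have "expectation (\<lambda>\<omega>. indicat_real A (X i \<omega>)) = p" .
    moreover have "integrable M (\<lambda>\<omega>. indicat_real A (X i \<omega>))"
      by (intro integrable_const_bound[where B = 1] AE_I2) (auto split: split_indicator)
    ultimately show ?thesis
      unfolding g_def by (simp add: prob_space)
  qed
  show ?int unfolding prod by (rule indep_vars_integrable[OF _ ind int]) auto
  have "expectation (\<lambda>\<omega>. exp (s * sample_count (\<lambda>i. X i \<omega>) n A)) = (1 + (exp s - 1) * p) ^ n"
    unfolding prod by (subst indep_vars_lebesgue_integral[OF _ ind int]) (auto simp: E)
  also have "\<dots> \<le> exp ((exp s - 1) * p) ^ n"
  proof (rule power_mono)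
    show "0 \<le> 1 + (exp s - 1) * p"
    proof -
      have "0 \<le> p" "p \<le> 1" using p[of 0] by (auto simp flip: p[of 0])
      then have "0 \<le> (1 - p) + exp s * p" by simp
      then show ?thesis by (simp add: algebra_simps)
    qed
  qed (use exp_ge_add_one_self in auto)
  also have "\<dots> = exp (real n * p * (exp s - 1))"
    by (simp add: exp_of_nat_mult[symmetric] mult.commute mult.assoc)
  finally show ?le .
qed

text \<open>With Chernoff parameter \<open>\<epsilon>\<close> or \<open>- \<epsilon>\<close> the
  exponent is at most \<open>- \<epsilon>\<^sup>2 (c + n p) + \<epsilon>\<^sup>2 n p\<close>. The
  tolerance contains \<open>n p\<close> so that these parts cancel and the bound is uniform in
  \<open>p\<close>.\<close>

lemma prob_sample_count_deviation:
  fixes X :: "nat \<Rightarrow> 'a \<Rightarrow> real" and p c \<epsilon> :: real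
  assumes indep: "indep_vars (\<lambda>_. borel) X UNIV" and A: "A \<in> sets borel"
    and p: "\<And>i. prob (X i -` A \<inter> space M) = p"
    and \<epsilon>: "0 < \<epsilon>" "\<epsilon> \<le> 1"
  shows "prob {\<omega> \<in> space M. \<epsilon> * (c + real n * p) \<le> \<bar>sample_count (\<lambda>i. X i \<omega>) n A - real n * p\<bar>}
         \<le> 2 * exp (- (\<epsilon>\<^sup>2 * c))"
proof -
  have rv [measurable]: "X i \<in> borel_measurable M" for i
    using indep by (simp add: indep_vars_def)
  note A [measurable]
  have p0: "0 \<le> p" using p[of 0] by (auto simp flip: p[of 0])
  let ?S = "\<lambda>\<omega>. sample_count (\<lambda>i. X i \<omega>) n A"
  let ?t = "\<epsilon> * (c + real n * p)"
  have [measurable]: "?S \<in> borel_measurable M" unfolding sample_count_def by measurable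
  have tail: "exp (- s * (real n * p)) * exp (- \<epsilon> * ?t) *
      expectation (\<lambda>\<omega>. exp (s * ?S \<omega>)) \<le> exp (- (\<epsilon>\<^sup>2 * c))" if s: "\<bar>s\<bar> = \<epsilon>" for s
  proof -
    have "exp s - 1 \<le> s + s\<^sup>2" using exp_le_quadratic[of s] s \<epsilon> by simp
    then have "real n * p * (exp s - 1) \<le> real n * p * (s + \<epsilon>\<^sup>2)"
      using p0 s by (intro mult_left_mono) (auto simp: power2_eq_square abs_if split: if_splits)
    then have "expectation (\<lambda>\<omega>. exp (s * ?S \<omega>)) \<le> exp (real n * p * (s + \<epsilon>\<^sup>2))"
      using mgf_sample_count(2)[OF indep A p, of s n] by (smt (verit) exp_le_cancel_iff)
    then have "exp (- s * (real n * p)) * exp (- \<epsilon> * ?t) * expectation (\<lambda>\<omega>. exp (s * ?S \<omega>))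
       \<le> exp (- s * (real n * p)) * exp (- \<epsilon> * ?t) * exp (real n * p * (s + \<epsilon>\<^sup>2))"
      by (intro mult_left_mono) auto
    also have "\<dots> = exp (- (\<epsilon>\<^sup>2 * c))"
      by (simp add: exp_add[symmetric] algebra_simps power2_eq_square)
    finally show ?thesis .
  qed
  have U: "prob {\<omega> \<in> space M. real n * p + ?t \<le> ?S \<omega>} \<le> exp (- (\<epsilon>\<^sup>2 * c))"
  proof -
    have "prob {\<omega> \<in> space M. real n * p + ?t \<le> ?S \<omega>}
      \<le> exp (- \<epsilon> * (real n * p + ?t)) * (\<integral>\<omega>\<in>space M. exp (\<epsilon> * ?S \<omega>) \<partial>M)"
      using \<epsilon> mgf_sample_count(1)[OF indep A p, of \<epsilon> n]
      by (intro Chernoff_ineq_ge) (auto simp: set_integrable_def cong: Bochner_Integration.integrable_cong)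
    also have "\<dots> = exp (- \<epsilon> * (real n * p)) * exp (- \<epsilon> * ?t) * expectation (\<lambda>\<omega>. exp (\<epsilon> * ?S \<omega>))"
      by (simp add: set_integral_space mgf_sample_count(1)[OF indep A p] algebra_simps flip: exp_add)
    finally show ?thesis using tail[of \<epsilon>] \<epsilon> by simp
  qed
  have L: "prob {\<omega> \<in> space M. ?S \<omega> \<le> real n * p - ?t} \<le> exp (- (\<epsilon>\<^sup>2 * c))"
  proof -
    have "prob {\<omega> \<in> space M. ?S \<omega> \<le> real n * p - ?t}
      \<le> exp (\<epsilon> * (real n * p - ?t)) * (\<integral>\<omega>\<in>space M. exp (- \<epsilon> * ?S \<omega>) \<partial>M)"
      using \<epsilon> mgf_sample_count(1)[OF indep A p, of "- \<epsilon>" n]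
      by (intro Chernoff_ineq_le) (auto simp: set_integrable_def cong: Bochner_Integration.integrable_cong)
    also have "\<dots> = exp (- (- \<epsilon>) * (real n * p)) * exp (- \<epsilon> * ?t) * expectation (\<lambda>\<omega>. exp (- \<epsilon> * ?S \<omega>))"
      using mgf_sample_count(1)[OF indep A p, of "- \<epsilon>" n]
      by (simp add: set_integral_space algebra_simps flip: exp_add)
    finally show ?thesis using tail[of "- \<epsilon>"] \<epsilon> by simp
  qed
  have "{\<omega> \<in> space M. ?t \<le> \<bar>?S \<omega> - real n * p\<bar>} \<subseteq>
      {\<omega> \<in> space M. real n * p + ?t \<le> ?S \<omega>} \<union> {\<omega> \<in> space M. ?S \<omega> \<le> real n * p - ?t}"
    by auto
  then have "prob {\<omega> \<in> space M. ?t \<le> \<bar>?S \<omega> - real n * p\<bar>} \<le>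
     prob ({\<omega> \<in> space M. real n * p + ?t \<le> ?S \<omega>} \<union> {\<omega> \<in> space M. ?S \<omega> \<le> real n * p - ?t})"
    by (intro finite_measure_mono) auto
  also have "\<dots> \<le> prob {\<omega> \<in> space M. real n * p + ?t \<le> ?S \<omega>} + prob {\<omega> \<in> space M. ?S \<omega> \<le> real n * p - ?t}"
    by (intro measure_Un_le) auto
  finally show ?thesis using U L by simp
qed

end

section \<open>The quantile grid of a diffuse distribution\<close>

lemma (in real_distribution) quantile_exists:
  assumes cont: "\<And>x. measure M {x} = 0" and u: "0 < u" "u < 1"
  shows "\<exists>q. cdf M q = u"
proof -
  have "\<forall>\<^sub>F x in at_bot. cdf M x < u"
    using cdf_lim_at_bot u(1) by (rule order_tendstoD)
  then obtain a where a: "cdf M a < u" by (metis eventually_at_bot_linorder order_refl)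
  have "\<forall>\<^sub>F x in at_top. u < cdf M x"
    using cdf_lim_at_top_prob u(2) by (rule order_tendstoD)
  then obtain b where b: "u < cdf M b" by (metis eventually_at_top_linorder order_refl)
  have "a \<le> b" using a b cdf_nondecreasing[of b a] by linarith
  then show ?thesis
    using IVT[of "cdf M" a u b] a b cont by (auto simp: isCont_cdf)
qed

text \<open>At the ends \<open>k = 0\<close> and \<open>l = n\<close> the cell is unbounded, since \<open>Q 0\<close> and \<open>Q 1\<close> need not be
  quantiles.\<close>

definition quantile_cell :: "(real \<Rightarrow> real) \<Rightarrow> nat \<Rightarrow> nat \<Rightarrow> nat \<Rightarrow> real set" where
  "quantile_cell Q n k l = {x. (0 < k \<longrightarrow> Q (k / n) < x) \<and> (l < n \<longrightarrow> x \<le> Q (l / n))}"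

lemma quantile_cell_cases:
  assumes "k < l" "l \<le> n"
  shows "quantile_cell Q n k l =
    (if k = 0 then if l = n then UNIV else {..Q (l / n)}
     else if l = n then {Q (k / n)<..} else {Q (k / n)<..Q (l / n)})"
  using assms by (auto simp: quantile_cell_def)

lemma quantile_cell_sets: "quantile_cell Q n k l \<in> sets borel"
  unfolding quantile_cell_def by measurable

text \<open>Each end of a cell is an exact quantile or infinite, so the expected number of
  observations in the cell is the integer \<open>l - k\<close>, whatever the distribution.\<close>

lemma (in real_distribution) measure_quantile_cell:
  assumes Q: "\<And>u. 0 < u \<Longrightarrow> u < 1 \<Longrightarrow> cdf M (Q u) = u" and kl: "k < l" "l \<le> n"
  shows "measure M (quantile_cell Q n k l) = (real l - real k) / real n"
proof -
  have n: "0 < real n" using kl by simp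
  have mk: "cdf M (Q (k / n)) = k / n" if "0 < k" using that kl n by (intro Q) auto
  have ml: "cdf M (Q (l / n)) = l / n" if "l < n" using that kl n by (intro Q) auto
  have lt: "Q (k / n) < Q (l / n)" if "0 < k" "l < n"
    using that mk ml cdf_nondecreasing[of "Q (l / n)" "Q (k / n)"] kl n
    by (metis divide_le_cancel linorder_not_le of_nat_le_iff order_less_asym)
  have c: "measure M {a<..} = 1 - cdf M a" for a
  proof -
    have "{a<..} = space M - {..a}" by auto
    then show ?thesis using prob_compl[of "{..a}"] by (simp add: cdf_def2)
  qed
  have "cdf M (Q (l / n)) - cdf M (Q (k / n)) = (real l - real k) / real n" if "0 < k" "l < n"
    using that mk ml by (simp add: diff_divide_distrib)
  moreover have "1 - cdf M (Q (k / n)) = (real n - real k) / real n" if "0 < k"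
    using that mk n by (simp add: diff_divide_distrib)
  ultimately show ?thesis
    unfolding quantile_cell_cases[OF kl]
    using n kl ml lt cdf_diff_eq[of "Q (k / n)" "Q (l / n)"] prob_space
    by (auto simp: c cdf_def2[symmetric])
qed

text \<open>An interval is enclosed by a block of consecutive grid cells and, unless its mass is at
  most \<open>2 / n\<close>, encloses another one; each block differs from it by mass at most
  \<open>2 / n\<close>. There are polynomially many blocks, so a union bound suffices. Closed
  intervals above and open ones below are the forms that apply between order statistics.\<close>

lemma AE_uniform_interval_counts:
  fixes X :: "nat \<Rightarrow> 'a \<Rightarrow> real" and m :: "nat \<Rightarrow> nat" and \<mu> :: "real measure"
  assumes "prob_space M"
    and indep: "prob_space.indep_vars M (\<lambda>_. borel) X UNIV"
    and distr: "\<And>i. distr M borel (X i) = \<mu>"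
    and diffuse: "\<And>x. measure \<mu> {x} = 0"
    and m: "filterlim m at_top sequentially"
    and m_ln: "filterlim (\<lambda>n. real (m n) / ln (real n)) at_top sequentially"
  shows "AE \<omega> in M. \<forall>\<epsilon>>0. \<forall>\<^sub>F n in sequentially. \<forall>a b. a \<le> b \<longrightarrow>
     sample_count (\<lambda>i. X i \<omega>) n {a..b} \<le>
       real n * (cdf \<mu> b - cdf \<mu> a) + \<epsilon> * (real (m n) + real n * (cdf \<mu> b - cdf \<mu> a)) \<and>
     real n * (cdf \<mu> b - cdf \<mu> a) - \<epsilon> * (real (m n) + real n * (cdf \<mu> b - cdf \<mu> a)) \<le>
       sample_count (\<lambda>i. X i \<omega>) n {a<..<b}"
proof -
  interpret prob_space M by fact
  have rv [measurable]: "X i \<in> borel_measurable M" for i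
    using indep by (simp add: indep_vars_def)
  interpret \<mu>: real_distribution \<mu>
    unfolding distr[of 0, symmetric] by (rule real_distribution_distr) measurable
  obtain Q where Q: "\<And>u. 0 < u \<Longrightarrow> u < 1 \<Longrightarrow> cdf \<mu> (Q u) = u"
    using \<mu>.quantile_exists[OF diffuse] by metis
  define G where "G = quantile_cell Q"
  have [measurable]: "G n k l \<in> sets borel" for n k l
    unfolding G_def by (rule quantile_cell_sets)
  define dev where "dev = (\<lambda>\<epsilon> n (k::nat) (l::nat). {\<omega> \<in> space M. \<epsilon> * (real (m n) + (real l - real k)) \<le>
     \<bar>sample_count (\<lambda>i. X i \<omega>) n (G n k l) - (real l - real k)\<bar>})"
  \<comment> \<open>All pairs \<open>k < l\<close> enter rather than single cells, since adding up
    the errors of single cells would multiply the tolerance by their number.\<close>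
  define bad where "bad = (\<lambda>\<epsilon> n. \<Union>kl\<in>{(k, l). k < l \<and> l \<le> n}. dev \<epsilon> n (fst kl) (snd kl))"
  have fin: "finite {(k, l). k < l \<and> l \<le> n}" for n :: nat
    by (rule finite_subset[of _ "{..n} \<times> {..n}"]) auto
  have [measurable]: "dev \<epsilon> n k l \<in> sets M" for \<epsilon> n k l
    unfolding dev_def sample_count_def by measurable
  have [measurable]: "bad \<epsilon> n \<in> sets M" for \<epsilon> n
    unfolding bad_def by (intro sets.finite_UN fin) auto
  have dev_le: "prob (dev \<epsilon> n k l) \<le> 2 * exp (- (\<epsilon>\<^sup>2 * real (m n)))"
    if kl: "k < l" "l \<le> n" and \<epsilon>: "0 < \<epsilon>" "\<epsilon> \<le> 1" for \<epsilon> n k l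
  proof -
    have "prob (X i -` G n k l \<inter> space M) = (real l - real k) / real n" for i
      using \<mu>.measure_quantile_cell[OF Q kl] unfolding G_def[symmetric]
      by (simp add: distr[of i, symmetric] measure_distr)
    from prob_sample_count_deviation[OF indep _ this \<epsilon>, of "real (m n)" n] show ?thesis
      using kl by (simp add: dev_def)
  qed
  have bad_le: "prob (bad \<epsilon> n) \<le> (real n + 1)\<^sup>2 * (2 * exp (- (\<epsilon>\<^sup>2 * real (m n))))"
    if \<epsilon>: "0 < \<epsilon>" "\<epsilon> \<le> 1" for \<epsilon> n
  proof -
    have "card {(k, l). k < l \<and> l \<le> n} \<le> card ({..n} \<times> {..n})"
      by (rule card_mono) auto
    then have "card {(k, l). k < l \<and> l \<le> n} \<le> (n + 1)\<^sup>2"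
      by (simp add: power2_eq_square)
    then have card: "real (card {(k, l). k < l \<and> l \<le> n}) \<le> (real n + 1)\<^sup>2"
      by (metis of_nat_1 of_nat_add of_nat_le_iff of_nat_power)
    have "prob (bad \<epsilon> n) \<le> (\<Sum>kl\<in>{(k, l). k < l \<and> l \<le> n}. prob (dev \<epsilon> n (fst kl) (snd kl)))"
      unfolding bad_def by (intro finite_measure_subadditive_finite fin) auto
    also have "\<dots> \<le> (\<Sum>kl\<in>{(k, l). k < l \<and> l \<le> n}. 2 * exp (- (\<epsilon>\<^sup>2 * real (m n))))"
      using \<epsilon> by (intro sum_mono) (auto intro!: dev_le simp del: mult_le_cancel_left)
    also have "\<dots> \<le> (real n + 1)\<^sup>2 * (2 * exp (- (\<epsilon>\<^sup>2 * real (m n))))"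
      using card by (simp add: mult_right_mono)
    finally show ?thesis .
  qed
  have summ: "summable (\<lambda>n. prob (bad \<epsilon> n))" if \<epsilon>: "0 < \<epsilon>" "\<epsilon> \<le> 1" for \<epsilon>
  proof (rule summable_comparison_test_ev)
    \<comment> \<open>The constant 4 bounds the exponential by the inverse of \<open>n ^ 4\<close>;
      against at most \<open>(n + 1)\<^sup>2\<close> pairs this leaves order
      \<open>1 / n\<^sup>2\<close>, which is summable.\<close>
    have "\<forall>\<^sub>F n in sequentially. 4 / \<epsilon>\<^sup>2 \<le> real (m n) / ln (real n)"
      using m_ln unfolding filterlim_at_top by blast
    then show "\<forall>\<^sub>F n in sequentially. norm (prob (bad \<epsilon> n)) \<le> 8 * inverse ((real n)\<^sup>2)"
      using eventually_gt_at_top[of 1]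
    proof eventually_elim
      case (elim n)
      then have n: "1 < real n" and ln: "0 < ln (real n)" by auto
      have "4 * ln (real n) \<le> \<epsilon>\<^sup>2 * real (m n)"
        using elim(1) ln \<epsilon> by (simp add: field_simps)
      then have "exp (- (\<epsilon>\<^sup>2 * real (m n))) \<le> exp (- (4 * ln (real n)))" by simp
      also have "\<dots> = inverse ((real n) ^ 4)"
        using n by (simp add: exp_minus exp_of_nat_mult[of 4, simplified])
      finally have "prob (bad \<epsilon> n) \<le> (real n + 1)\<^sup>2 * (2 * inverse ((real n) ^ 4))"
        using bad_le[OF \<epsilon>, of n] by (smt (verit, best) mult_left_mono zero_le_power2)
      also have "\<dots> \<le> (2 * real n)\<^sup>2 * (2 * inverse ((real n) ^ 4))"
        using n by (intro mult_right_mono power_mono) auto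
      also have "\<dots> = 8 * inverse ((real n)\<^sup>2)"
        using n by (simp add: field_simps power2_eq_square power4_eq_xxxx)
      finally show ?case by simp
    qed
    show "summable (\<lambda>n. 8 * inverse ((real n)\<^sup>2))"
      by (intro summable_mult inverse_power_summable) auto
  qed
  \<comment> \<open>Only countably many tolerances are used, so that their exceptional null sets can
    be united.\<close>
  have "AE \<omega> in M. \<forall>r. \<forall>\<^sub>F n in sequentially. \<omega> \<in> space M - bad (1 / real (Suc r)) n"
    unfolding AE_all_countable
    by (intro allI borel_cantelli_AE1 summ) (auto simp: less_top[symmetric] divide_simps)
  then show ?thesis
  proof eventually_elim
    case (elim \<omega>)
    show ?case
    proof (intro allI impI)
      fix \<epsilon> :: real assume "0 < \<epsilon>"
      then obtain r where r: "1 / real (Suc r) < \<epsilon> / 2"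
        using nat_approx_posE[of "\<epsilon> / 2"] by auto
      \<comment> \<open>Half of \<open>\<epsilon>\<close> covers the random deviation, the other
        half the rounding to the grid, which costs at most
        \<open>2 + 2 * \<delta> \<le> 4 \<le> \<delta> * m\<close>.\<close>
      define \<delta> where "\<delta> = 1 / real (Suc r)"
      have \<delta>: "0 < \<delta>" "\<delta> \<le> 1" "2 * \<delta> \<le> \<epsilon>" using r by (auto simp: \<delta>_def divide_simps)
      have "filterlim (\<lambda>n. real (m n)) at_top sequentially"
        by (rule filterlim_compose[OF filterlim_real_sequentially m])
      then have "\<forall>\<^sub>F n in sequentially. 4 / \<delta> \<le> real (m n)"
        unfolding filterlim_at_top by blast
      moreover have "\<forall>\<^sub>F n in sequentially. \<omega> \<in> space M - bad \<delta> n"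
        using elim unfolding \<delta>_def by blast
      ultimately show "\<forall>\<^sub>F n in sequentially. \<forall>a b. a \<le> b \<longrightarrow>
         sample_count (\<lambda>i. X i \<omega>) n {a..b} \<le>
           real n * (cdf \<mu> b - cdf \<mu> a) + \<epsilon> * (real (m n) + real n * (cdf \<mu> b - cdf \<mu> a)) \<and>
         real n * (cdf \<mu> b - cdf \<mu> a) - \<epsilon> * (real (m n) + real n * (cdf \<mu> b - cdf \<mu> a)) \<le>
           sample_count (\<lambda>i. X i \<omega>) n {a<..<b}"
        using eventually_gt_at_top[of 0]
      proof eventually_elim
        case (elim n)
        let ?S = "sample_count (\<lambda>i. X i \<omega>) n"
        have n: "0 < real n" using elim by simp
        have m4: "4 \<le> \<delta> * real (m n)" using elim(1) \<delta> by (simp add: field_simps)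
        have cell: "\<bar>?S (G n k l) - (real l - real k)\<bar> \<le> \<delta> * (real (m n) + (real l - real k))"
          if "k < l" "l \<le> n" for k l
          using elim(2) that by (force simp: bad_def dev_def)
        show ?case
        proof (intro allI impI conjI)
          fix a b :: real assume ab: "a \<le> b"
          let ?A = "real n * cdf \<mu> a" and ?B = "real n * cdf \<mu> b"
          have AB: "0 \<le> ?A" "?A \<le> ?B" "?B \<le> real n"
            using ab n \<mu>.cdf_nonneg \<mu>.cdf_nondecreasing \<mu>.cdf_bounded_prob
            by (auto simp: mult_left_mono mult_left_le)
          have d: "real n * (cdf \<mu> b - cdf \<mu> a) = ?B - ?A" by (simp add: algebra_simps)
          have Q_less: "Q u < x" if "0 < u" "u < 1" "u < cdf \<mu> x" for u x
            using Q[OF that(1,2)] that(3) \<mu>.cdf_nondecreasing[of x "Q u"] by linarith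
          have less_Q: "x < Q u" if "0 < u" "u < 1" "cdf \<mu> x < u" for u x
            using Q[OF that(1,2)] that(3) \<mu>.cdf_nondecreasing[of "Q u" x] by linarith
          {
            \<comment> \<open>Outer block: \<open>k\<close> is rounded strictly down and
              \<open>l\<close> strictly up, cut off at 0 and \<open>n\<close>. The cdf may have flat
              pieces, so it is the strict inequality \<open>k / n < cdf \<mu> a\<close> that forces
              \<open>Q (k / n) < a\<close>. At a cutoff the cell is unbounded on that side.\<close>
            define k where "k = nat (\<lceil>?A\<rceil> - 1)"
            define l where "l = min n (nat (\<lfloor>?B\<rfloor> + 1))"
            have k: "real k < ?A" if "0 < k" using that AB unfolding k_def by linarith
            have k': "?A \<le> real k + 1" unfolding k_def by linarith
            have l: "?B < real l" if "l < n" using that AB unfolding l_def by linarith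
            have l': "real l \<le> ?B + 1" using AB unfolding l_def by linarith
            have ln: "l \<le> n" by (simp add: l_def)
            have kl: "k < l"
            proof (cases "0 < k")
              case True
              have "?B \<le> real l" using l ln AB(3) by (cases "l = n") auto
              then have "real k < real l" using k[OF True] AB(2) by linarith
              then show ?thesis by simp
            next
              case False
              moreover have "0 \<le> ?B" using AB by linarith
              then have "0 < l" using n unfolding l_def by simp
              ultimately show ?thesis by simp
            qed
            have "{a..b} \<subseteq> G n k l"
            proof
              fix x assume x: "x \<in> {a..b}"
              have "Q (k / n) < x" if "0 < k"
              proof -
                have "Q (k / n) < a" using k[OF that] that kl ln n by (intro Q_less) (auto simp: field_simps)
                then show ?thesis using x by simp
              qed
              moreover have "x \<le> Q (l / n)" if "l < n"
              proof -
                have "b < Q (l / n)" using l[OF that] that kl n by (intro less_Q) (auto simp: field_simps)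
                then show ?thesis using x by simp
              qed
              ultimately show "x \<in> G n k l" by (auto simp: G_def quantile_cell_def)
            qed
            then have "?S {a..b} \<le> ?S (G n k l)" by (rule sample_count_mono)
            also have "\<dots> \<le> (real l - real k) + \<delta> * (real (m n) + (real l - real k))"
              using cell[OF kl ln] by linarith
            also have "\<dots> \<le> (?B - ?A + 2) + \<delta> * (real (m n) + (?B - ?A + 2))"
              using k' l' \<delta> by (intro add_mono mult_left_mono) auto
            also have "\<dots> \<le> (?B - ?A) + 2 * \<delta> * (real (m n) + (?B - ?A))"
            proof -
              have "0 \<le> \<delta> * (?B - ?A)" using \<delta> AB by simp
              moreover have "\<delta> * 2 \<le> 2" using \<delta> by simp
              ultimately show ?thesis using m4 by (simp only: distrib_left distrib_right mult.assoc)
            qed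
            also have "\<dots> \<le> (?B - ?A) + \<epsilon> * (real (m n) + (?B - ?A))"
              using \<delta> AB by (intro add_mono mult_right_mono) auto
            finally show "?S {a..b} \<le> real n * (cdf \<mu> b - cdf \<mu> a)
               + \<epsilon> * (real (m n) + real n * (cdf \<mu> b - cdf \<mu> a))"
              unfolding d .
          }
          \<comment> \<open>Inner block: \<open>k\<close> is rounded strictly up and
            \<open>l\<close> strictly down. If \<open>k < l\<close> fails, then
            \<open>?B - ?A \<le> 2\<close> and the claimed lower bound is negative.\<close>
          define k where "k = nat (\<lfloor>?A\<rfloor> + 1)"
          define l where "l = nat (\<lceil>?B\<rceil> - 1)"
          have k: "?A < real k" "real k \<le> ?A + 1" "0 < k" using AB unfolding k_def by linarith+
          have l': "?B \<le> real l + 1" using AB unfolding l_def by linarith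
          have l: "real l < ?B" if "0 < l" using that unfolding l_def by linarith
          have "(?B - ?A) - 2 * \<delta> * (real (m n) + (?B - ?A)) \<le> ?S {a<..<b}"
          proof (cases "k < l")
            case True
            with l have lB: "real l < ?B" by simp
            then have ln: "l < n" using AB by simp
            have "G n k l \<subseteq> {a<..<b}"
            proof
              fix x assume x: "x \<in> G n k l"
              have "a < Q (k / n)" using k True ln n by (intro less_Q) (auto simp: field_simps)
              moreover have "Q (l / n) < b" using lB True ln n by (intro Q_less) (auto simp: field_simps)
              ultimately show "x \<in> {a<..<b}" using x k ln by (auto simp: G_def quantile_cell_def)
            qed
            then have "?S (G n k l) \<le> ?S {a<..<b}" by (rule sample_count_mono)
            moreover have "(real l - real k) - \<delta> * (real (m n) + (real l - real k)) \<le> ?S (G n k l)"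
              using cell[OF True less_imp_le[OF ln]] by linarith
            moreover have "\<delta> * (real l - real k) \<le> \<delta> * (?B - ?A)"
              using \<delta> k lB by (intro mult_left_mono) auto
            moreover have "0 \<le> \<delta> * (?B - ?A)" using \<delta> AB by simp
            ultimately show ?thesis
              using m4 k l' by (simp only: distrib_left distrib_right mult.assoc)
          next
            case False
            then have "?B - ?A \<le> 2" using k l' by linarith
            moreover have "0 \<le> \<delta> * (?B - ?A)" using \<delta> AB by simp
            moreover have "0 \<le> ?S {a<..<b}" by (rule sample_count_nonneg)
            ultimately show ?thesis
              using m4 by (simp only: distrib_left distrib_right mult.assoc)
          qed
          moreover have "2 * \<delta> * (real (m n) + (?B - ?A)) \<le> \<epsilon> * (real (m n) + (?B - ?A))"
            using \<delta> AB by (intro mult_right_mono) auto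
          ultimately show "real n * (cdf \<mu> b - cdf \<mu> a)
              - \<epsilon> * (real (m n) + real n * (cdf \<mu> b - cdf \<mu> a)) \<le> ?S {a<..<b}"
            unfolding d by linarith
        qed
      qed
    qed
  qed
qed

subsection \<open>Differentiation and uniform limits\<close>

text \<open>Lebesgue differentiation enters as convergence of right-sided averages; applied also to
  the reflected function it yields the left-sided ones, hence a two-sided derivative.\<close>

lemma AE_has_real_derivative_indefinite_integral:
  fixes f F :: "real \<Rightarrow> real"
  assumes f: "integrable lborel f"
    and F: "\<And>a b. a \<le> b \<Longrightarrow> F b - F a = (LBINT z:{a..b}. f z)"
  shows "AE z in lborel. (F has_real_derivative f z) (at z)"
proof -
  have int: "set_integrable lborel {a..b} f" for a b
    using f unfolding set_integrable_def by (intro integrable_mult_indicator) auto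
  have HK: "f integrable_on {a..b}" "a \<le> b \<Longrightarrow> F b - F a = integral {a..b} f" for a b
    using set_borel_integral_eq_integral[OF int] F by auto
  obtain N1 where N1: "negligible N1" and R:
    "\<And>x e. x \<notin> N1 \<Longrightarrow> 0 < e \<Longrightarrow> \<exists>d>0. \<forall>h. 0 < h \<and> h < d \<longrightarrow>
       norm (integral (cbox x (x + h *\<^sub>R One)) f /\<^sub>R h ^ DIM(real) - f x) < e"
    using integrable_ccontinuous_explicit[of f] HK(1) by (auto simp: cbox_interval)
  have HK': "(\<lambda>z. f (- z)) integrable_on {a..b}" for a b
    using Henstock_Kurzweil_Integration.integrable_reflect_real[of f "- a" "- b"] HK(1)[of "- b" "- a"] by simp
  obtain N2 where N2: "negligible N2" and L:
    "\<And>x e. x \<notin> N2 \<Longrightarrow> 0 < e \<Longrightarrow> \<exists>d>0. \<forall>h. 0 < h \<and> h < d \<longrightarrow>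
       norm (integral (cbox x (x + h *\<^sub>R One)) (\<lambda>z. f (- z)) /\<^sub>R h ^ DIM(real) - f (- x)) < e"
    using integrable_ccontinuous_explicit[of "\<lambda>z. f (- z)"] HK' by (auto simp: cbox_interval)
  \<comment> \<open>The exceptional points of the reflected function are reflected back, which keeps
    them negligible because reflection is differentiable.\<close>
  have "negligible (N1 \<union> uminus ` N2)"
    using N1 N2 by (intro negligible_Un negligible_differentiable_image_negligible) (auto intro!: derivative_intros simp: differentiable_on_def)
  then have "N1 \<union> uminus ` N2 \<in> null_sets lebesgue"
    by (simp add: negligible_iff_null_sets)
  then have "AE z in lborel. z \<notin> N1 \<union> uminus ` N2"
    by (rule AE_completion_iff[THEN iffD1, OF AE_not_in])
  then show ?thesis
  proof eventually_elim
    case (elim z)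
    then have z1: "z \<notin> N1" and z2: "- z \<notin> N2" by (auto simp: image_iff)
    have "((\<lambda>h. (F (z + h) - F z) / h) \<longlongrightarrow> f z) (at 0)"
    proof (rule LIM_I)
      fix e :: real assume e: "0 < e"
      from R[OF z1 e] obtain d1 where d1: "0 < d1" and
        R1: "\<And>h. 0 < h \<Longrightarrow> h < d1 \<Longrightarrow> \<bar>integral {z..z + h} f / h - f z\<bar> < e"
        by (auto simp: divide_inverse mult.commute)
      from L[OF z2 e] obtain d2 where d2: "0 < d2" and
        L1: "\<And>h. 0 < h \<Longrightarrow> h < d2 \<Longrightarrow> \<bar>integral {- z..- z + h} (\<lambda>z. f (- z)) / h - f z\<bar> < e"
        by (auto simp: divide_inverse mult.commute)
      show "\<exists>s>0. \<forall>h. h \<noteq> 0 \<and> norm (h - 0) < s \<longrightarrow> norm ((F (z + h) - F z) / h - f z) < e"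
      proof (intro exI[of _ "min d1 d2"] conjI allI impI)
        fix h :: real assume h: "h \<noteq> 0 \<and> norm (h - 0) < min d1 d2"
        show "norm ((F (z + h) - F z) / h - f z) < e"
        proof (cases "0 < h")
          case True
          then show ?thesis using R1[of h] HK(2)[of z "z + h"] h by simp
        next
          case False
          then have neg: "0 < - h" "- h < d2" using h by auto
          have "integral {- z..- z + - h} (\<lambda>z. f (- z)) = integral {z + h..z} f"
            using Henstock_Kurzweil_Integration.integral_reflect_real[of z "z + h" f]
            by (simp add: algebra_simps)
          also have "\<dots> = F z - F (z + h)" using HK(2)[of "z + h" z] neg by simp
          finally have "\<bar>(F z - F (z + h)) / (- h) - f z\<bar> < e" using L1[OF neg] by simp
          moreover have "(F z - F (z + h)) / (- h) = (F (z + h) - F z) / h"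
            by (metis minus_diff_eq minus_divide_divide)
          ultimately show ?thesis by simp
        qed
      qed (use d1 d2 in simp)
    qed
    then show ?case by (simp add: DERIV_def)
  qed
qed

text \<open>Since \<open>z\<close> separates the endpoints, the first-order errors
  \<open>e / 2 * (b - z)\<close> and \<open>e / 2 * (z - a)\<close> add up to
  \<open>e / 2 * (b - a)\<close>, which survives division by \<open>b - a\<close>.\<close>

lemma tendsto_straddled_difference_quotient:
  fixes F :: "real \<Rightarrow> real"
  assumes F: "(F has_real_derivative D) (at z)"
    and a: "(a \<longlongrightarrow> z) G" and b: "(b \<longlongrightarrow> z) G"
    and ev: "\<forall>\<^sub>F i in G. a i < z \<and> z \<le> b i"
  shows "((\<lambda>i. (F (b i) - F (a i)) / (b i - a i)) \<longlongrightarrow> D) G"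
proof (rule tendstoI)
  fix e :: real assume e: "0 < e"
  have "(F has_derivative (\<lambda>h. D * h)) (at z)"
    using F by (simp add: has_field_derivative_def)
  then obtain d where d: "0 < d" and
    bound: "\<And>y. norm (y - z) < d \<Longrightarrow> norm (F y - F z - D * (y - z)) \<le> e / 2 * norm (y - z)"
    using e unfolding has_derivative_at_alt by (metis half_gt_zero)
  show "\<forall>\<^sub>F i in G. dist ((F (b i) - F (a i)) / (b i - a i)) D < e"
    using ev tendstoD[OF a d] tendstoD[OF b d]
  proof eventually_elim
    case (elim i)
    have ab: "0 < b i - a i" using elim by simp
    have "F (b i) - F (a i) - D * (b i - a i) =
        (F (b i) - F z - D * (b i - z)) - (F (a i) - F z - D * (a i - z))"
      by (simp add: algebra_simps)
    also have "\<bar>\<dots>\<bar> \<le> \<bar>F (b i) - F z - D * (b i - z)\<bar> + \<bar>F (a i) - F z - D * (a i - z)\<bar>"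
      by (rule abs_triangle_ineq4)
    also have "\<dots> \<le> e / 2 * (b i - z) + e / 2 * (z - a i)"
      using bound[of "a i"] bound[of "b i"] elim
      by (intro add_mono) (auto simp: dist_real_def)
    also have "\<dots> = e / 2 * (b i - a i)" by (simp flip: distrib_left)
    finally have "\<bar>F (b i) - F (a i) - D * (b i - a i)\<bar> \<le> e / 2 * (b i - a i)" .
    also have "\<dots> < e * (b i - a i)" using ab e by simp
    finally have "\<bar>F (b i) - F (a i) - D * (b i - a i)\<bar> < e * (b i - a i)" .
    moreover have "(F (b i) - F (a i)) / (b i - a i) - D = (F (b i) - F (a i) - D * (b i - a i)) / (b i - a i)"
      using ab by (simp add: field_simps)
    ultimately show ?case using ab by (simp add: dist_real_def divide_less_eq)
  qed
qed

text \<open>Convergence along \<open>uniformly_along J\<close> is convergence as \<open>n\<close> tends to infinity, uniformly over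
  the indices \<open>j \<in> J n\<close>.\<close>

definition uniformly_along :: "(nat \<Rightarrow> nat set) \<Rightarrow> (nat \<times> nat) filter" where
  "uniformly_along J = inf (filtercomap fst sequentially) (principal {(n, j). j \<in> J n})"

lemma eventually_uniformly_along:
  "eventually P (uniformly_along J) \<longleftrightarrow> (\<forall>\<^sub>F n in sequentially. \<forall>j\<in>J n. P (n, j))"
  unfolding uniformly_along_def eventually_inf_principal eventually_filtercomap
proof
  assume "\<exists>Q. eventually Q sequentially \<and> (\<forall>i. Q (fst i) \<longrightarrow> i \<in> {(n, j). j \<in> J n} \<longrightarrow> P i)"
  then obtain Q where "eventually Q sequentially" "\<And>n j. Q n \<Longrightarrow> j \<in> J n \<Longrightarrow> P (n, j)" by auto
  then show "\<forall>\<^sub>F n in sequentially. \<forall>j\<in>J n. P (n, j)" by (auto elim: eventually_mono)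
next
  assume "\<forall>\<^sub>F n in sequentially. \<forall>j\<in>J n. P (n, j)"
  then show "\<exists>Q. eventually Q sequentially \<and> (\<forall>i. Q (fst i) \<longrightarrow> i \<in> {(n, j). j \<in> J n} \<longrightarrow> P i)"
    by (intro exI[of _ "\<lambda>n. \<forall>j\<in>J n. P (n, j)"]) auto
qed

lemma uniformly_along_mono: "(\<And>n. J n \<subseteq> K n) \<Longrightarrow> uniformly_along J \<le> uniformly_along K"
  by (auto simp: le_filter_def eventually_uniformly_along elim!: eventually_mono)

lemma filterlim_fst_uniformly_along: "filterlim fst sequentially (uniformly_along J)"
  unfolding uniformly_along_def
  by (rule filterlim_mono[OF filterlim_filtercomap order_refl]) simp

subsection \<open>Order statistics and spacings\<close>

text \<open>Sorting preserves the multiset of observations, so tied values occupy as many ranks as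
  their multiplicity.\<close>

lemma sample_count_order_stat:
  "sample_count x n A = real (card {j \<in> {1..n}. order_stat x n j \<in> A})"
proof -
  let ?l = "map x [0..<n]"
  have "card {i. i < n \<and> x i \<in> A} = length (filter (\<lambda>y. y \<in> A) ?l)"
    by (simp add: length_filter_conv_card) (rule arg_cong[of _ _ card], auto)
  also have "\<dots> = size (filter_mset (\<lambda>y. y \<in> A) (mset ?l))"
    by (metis mset_filter size_mset)
  also have "\<dots> = length (filter (\<lambda>y. y \<in> A) (sort ?l))"
    by (metis mset_filter mset_sort size_mset)
  also have "\<dots> = card {i. i < n \<and> sort ?l ! i \<in> A}"
    by (simp add: length_filter_conv_card)
  also have "\<dots> = card (Suc ` {i. i < n \<and> sort ?l ! i \<in> A})"
    by (simp add: card_image)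
  also have "Suc ` {i. i < n \<and> sort ?l ! i \<in> A} = {j \<in> {1..n}. order_stat x n j \<in> A}"
  proof (rule set_eqI)
    fix j show "j \<in> Suc ` {i. i < n \<and> sort ?l ! i \<in> A} \<longleftrightarrow> j \<in> {j \<in> {1..n}. order_stat x n j \<in> A}"
      unfolding order_stat_def by (cases j) auto
  qed
  finally show ?thesis by (simp add: sample_count_eq_card)
qed

lemma order_stat_mono:
  assumes "1 \<le> j" "j \<le> k" "k \<le> n"
  shows "order_stat x n j \<le> order_stat x n k"
  unfolding order_stat_def by (rule sorted_nth_mono) (use assms in auto)

lemma order_stat_less_iff_rank:
  assumes j: "j \<in> {1..n}"
  shows "order_stat x n j < z \<longleftrightarrow> j \<le> card {k \<in> {1..n}. order_stat x n k < z}"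
proof -
  let ?S = "{k \<in> {1..n}. order_stat x n k < z}"
  show ?thesis
  proof
    assume "order_stat x n j < z"
    then have "{1..j} \<subseteq> ?S" using j order_stat_mono[of _ j n x] by fastforce
    then have "card {1..j} \<le> card ?S" by (intro card_mono) auto
    then show "j \<le> card ?S" by simp
  next
    assume le: "j \<le> card ?S"
    show "order_stat x n j < z"
    proof (rule ccontr)
      assume "\<not> order_stat x n j < z"
      then have "k < j" if "k \<in> ?S" for k
        using that j order_stat_mono[of j k n x] by (cases "k < j") auto
      then have "?S \<subseteq> {1..<j}" by auto
      then have "card ?S \<le> card {1..<j}" by (intro card_mono) auto
      then show False using le j by auto
    qed
  qed
qed

text \<open>The half-open convention makes these ranks, even with ties, a window of \<open>m\<close>
  consecutive ranks ending at the number of observations below \<open>z\<close>, cut to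
  \<open>{1..n - m}\<close>.\<close>

definition straddling :: "(nat \<Rightarrow> real) \<Rightarrow> nat \<Rightarrow> nat \<Rightarrow> real \<Rightarrow> nat set" where
  "straddling x n m z = {j \<in> {1..n - m}. order_stat x n j < z \<and> z \<le> order_stat x n (j + m)}"

lemma straddling_eq:
  defines "r \<equiv> \<lambda>x n z. card {k \<in> {1..n}. order_stat x n k < z}"
  shows "straddling x n m z = {j \<in> {1..n - m}. j \<le> r x n z \<and> r x n z < j + m}"
proof -
  have "order_stat x n j < z \<longleftrightarrow> j \<le> r x n z" "z \<le> order_stat x n (j + m) \<longleftrightarrow> r x n z < j + m"
    if "j \<in> {1..n - m}" for j
  proof -
    have "j \<in> {1..n}" "j + m \<in> {1..n}" using that by auto
    then show "order_stat x n j < z \<longleftrightarrow> j \<le> r x n z" "z \<le> order_stat x n (j + m) \<longleftrightarrow> r x n z < j + m"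
      using order_stat_less_iff_rank[of j n x z] order_stat_less_iff_rank[of "j + m" n x z]
      unfolding r_def by (metis linorder_not_le)+
  qed
  then show ?thesis unfolding straddling_def by blast
qed

lemma card_straddling_le: "card (straddling x n m z) \<le> m"
proof -
  let ?r = "card {k \<in> {1..n}. order_stat x n k < z}"
  have "straddling x n m z \<subseteq> {Suc ?r - m..<Suc ?r}"
    unfolding straddling_eq by auto
  then have "card (straddling x n m z) \<le> card {Suc ?r - m..<Suc ?r}" by (intro card_mono) auto
  then show ?thesis by simp
qed

text \<open>With \<open>r\<close> observations below \<open>z\<close>, the window from
  \<open>r - m + 1\<close> to \<open>r\<close> is left uncut when \<open>m \<le> r\<close> and
  \<open>m \<le> n - r\<close>.\<close>

lemma card_straddling:
  assumes "real m \<le> sample_count x n {..<z}" "real m \<le> sample_count x n {z..}"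
  shows "card (straddling x n m z) = m"
proof -
  let ?r = "card {k \<in> {1..n}. order_stat x n k < z}"
  have 1: "m \<le> ?r" using assms(1) unfolding sample_count_order_stat by simp
  have "{k \<in> {1..n}. z \<le> order_stat x n k} = {1..n} - {k \<in> {1..n}. order_stat x n k < z}" by auto
  moreover have "card ({1..n} - {k \<in> {1..n}. order_stat x n k < z}) = card {1..n} - ?r"
    by (rule card_Diff_subset) auto
  ultimately have "card {k \<in> {1..n}. z \<le> order_stat x n k} = n - ?r" by simp
  then have 2: "m \<le> n - ?r" using assms(2) unfolding sample_count_order_stat by simp
  have "?r \<le> card {1..n}" by (intro card_mono) auto
  then have "straddling x n m z = {Suc ?r - m..<Suc ?r}"
    unfolding straddling_eq using 1 2 by auto
  then show ?thesis using 1 by simp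
qed

subsection \<open>Averages over the ranks of a regular sample\<close>

text \<open>These properties hold for almost every realization, so all arguments inside are
  deterministic. The point -1 lies below every observation and \<open>F\<close> vanishes there, so
  bounded intervals starting at it can replace unbounded ones.\<close>

locale regular_sample =
  fixes x :: "nat \<Rightarrow> real" and f F :: "real \<Rightarrow> real" and m :: "nat \<Rightarrow> nat" and B :: real
  assumes f_nonneg: "0 \<le> f z" and f_le: "f z \<le> B" and f_integrable: "integrable lborel f"
    and F_diff: "a \<le> b \<Longrightarrow> F b - F a = (LBINT z:{a..b}. f z)"
    and F_nonneg: "0 \<le> F z" and F_le_1: "F z \<le> 1" and F_neg: "F (- 1) = 0"
    and x_nonneg: "0 \<le> x i"
    and m_bounds: "1 \<le> n \<Longrightarrow> 1 \<le> m n \<and> m n \<le> n"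
    and m_ratio: "(\<lambda>n. real (m n) / real n) \<longlonglongrightarrow> 0"
    and counts: "0 < \<epsilon> \<Longrightarrow> \<forall>\<^sub>F n in sequentially. \<forall>a b. a \<le> b \<longrightarrow>
      sample_count x n {a..b} \<le>
        real n * (F b - F a) + \<epsilon> * (real (m n) + real n * (F b - F a)) \<and>
      real n * (F b - F a) - \<epsilon> * (real (m n) + real n * (F b - F a)) \<le>
        sample_count x n {a<..<b}"
begin

abbreviation Y :: "nat \<Rightarrow> nat \<Rightarrow> real" where "Y n \<equiv> order_stat x n"

abbreviation J :: "nat \<Rightarrow> real \<Rightarrow> nat set" where "J n z \<equiv> straddling x n (m n) z"

lemma f_measurable [measurable]: "f \<in> borel_measurable borel"
  using borel_measurable_integrable[OF f_integrable] by simp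

lemma AE_F_derivative: "AE z in lborel. (F has_real_derivative f z) (at z)"
  using AE_has_real_derivative_indefinite_integral[OF f_integrable] F_diff by blast

lemma F_diff_halfopen:
  assumes "a \<le> b"
  shows "F b - F a = (\<integral>z. f z * indicator {a<..b} z \<partial>lborel)"
proof -
  have "(LBINT z:{a..b}. f z) = (\<integral>z. f z * indicator {a<..b} z \<partial>lborel)"
    unfolding set_lebesgue_integral_def
  proof (rule integral_cong_AE)
    show "AE z in lborel. indicat_real {a..b} z *\<^sub>R f z = f z * indicator {a<..b} z"
      using AE_lborel_singleton[of a] by eventually_elim (auto split: split_indicator)
  qed measurable
  then show ?thesis using F_diff[OF assms] by simp
qed

lemma F_mono:
  assumes "a \<le> b"
  shows "F a \<le> F b"
proof -
  have "0 \<le> F b - F a"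
    unfolding F_diff_halfopen[OF assms] using f_nonneg by (intro Bochner_Integration.integral_nonneg) auto
  then show ?thesis by simp
qed

lemma F_lipschitz:
  assumes "a \<le> b"
  shows "F b - F a \<le> B * (b - a)"
proof -
  have "F b - F a \<le> (\<integral>z. B * indicator {a<..b} z \<partial>lborel)"
    unfolding F_diff_halfopen[OF assms]
  proof (rule Bochner_Integration.integral_mono)
    show "integrable lborel (\<lambda>z. f z * indicator {a<..b} z)"
      using f_integrable by (intro integrable_real_mult_indicator) auto
    show "integrable lborel (\<lambda>z. B * indicator {a<..b} z)"
      by (intro Bochner_Integration.integrable_mult_right integrable_real_indicator)
         (use assms in auto)
  qed (use f_le in \<open>auto split: split_indicator\<close>)
  then show ?thesis using assms by simp
qed

lemma eventually_m_less: "\<forall>\<^sub>F n in sequentially. m n < n"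
  using order_tendstoD(2)[OF m_ratio zero_less_one] eventually_gt_at_top[of 0]
  by eventually_elim (auto simp: divide_simps split: if_splits)

lemma eventually_m_le_sample_count:
  assumes "F a < F b"
  shows "\<forall>\<^sub>F n in sequentially. real (m n) \<le> sample_count x n {a<..<b}"
proof -
  let ?d = "F b - F a"
  have ab: "a \<le> b" using assms F_mono[of b a] by linarith
  \<comment> \<open>The constant 3 is chosen because \<open>n p \<ge> 3 m\<close> makes half of
    \<open>n p\<close> minus half of \<open>m\<close> at least \<open>m\<close>.\<close>
  have "\<forall>\<^sub>F n in sequentially. real (m n) / real n < ?d / 3"
    using assms by (intro order_tendstoD(2)[OF m_ratio]) simp
  then show ?thesis
    using counts[OF half_gt_zero[OF zero_less_one]] eventually_gt_at_top[of 0]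
  proof eventually_elim
    case (elim n)
    have "real (m n) * 3 \<le> real n * ?d" using elim by (simp add: field_simps)
    moreover have "real n * ?d - (1 / 2) * (real (m n) + real n * ?d) \<le> sample_count x n {a<..<b}"
      using elim ab by (auto simp: field_simps)
    ultimately show ?case by (simp add: field_simps)
  qed
qed

lemma emp_cdf_tendsto:
  assumes t: "0 \<le> t"
  shows "(\<lambda>n. emp_cdf x n t) \<longlonglongrightarrow> F t"
proof (rule tendstoI)
  fix e :: real assume e: "0 < e"
  show "\<forall>\<^sub>F n in sequentially. dist (emp_cdf x n t) (F t) < e"
    \<comment> \<open>The spelled-out numeral is 4: with tolerance \<open>e / 4\<close> and
      \<open>m + n F t \<le> 2 n\<close> the error stays within \<open>e n / 2\<close>.\<close>
    using counts[OF divide_pos_pos[OF e zero_less_numeral, of "num.Bit0 (num.Bit0 num.One)"]]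
      eventually_gt_at_top[of 0]
  proof eventually_elim
    case (elim n)
    have n: "0 < real n" using elim by simp
    have emp: "emp_cdf x n t = sample_count x n {..t} / real n"
      unfolding emp_cdf_def sample_count_def by simp
    have eq: "sample_count x n {..t} = sample_count x n {-1..t}"
      unfolding sample_count_def
      by (intro sum.cong) (auto simp: indicator_def intro: order_trans[OF _ x_nonneg])
    have "real (m n) + real n * F t \<le> real n + real n * 1"
      using m_bounds[of n] elim F_le_1 by (intro add_mono mult_left_mono) auto
    then have err: "e / 4 * (real (m n) + real n * F t) \<le> e / 2 * real n"
      using e mult_left_mono[of "real (m n) + real n * F t" "2 * real n" "e / 4"] by simp
    have "sample_count x n {..t} \<le> real n * F t + e / 2 * real n"
      using elim(1)[rule_format, of "-1" t] t err F_neg eq by auto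
    moreover have "real n * F t - e / 2 * real n \<le> sample_count x n {..t}"
      using elim(1)[rule_format, of "-1" t] t err F_neg
        sample_count_mono[of "{-1<..<t}" "{..t}" x n] by fastforce
    ultimately have "\<bar>sample_count x n {..t} - real n * F t\<bar> \<le> e / 2 * real n" by linarith
    also have "\<dots> < e * real n" using n e by simp
    finally show ?case
      using n by (simp add: emp dist_real_def abs_less_iff field_simps)
  qed
qed

text \<open>From rank \<open>j\<close> to rank \<open>j + m\<close> the closed interval holds at
  least \<open>m\<close> observations and the open one at most \<open>m\<close>, ties included. The
  two count bounds therefore pin down its mass, simultaneously for all \<open>j\<close>.\<close>

lemma spacing_mass_tendsto:
  "((\<lambda>(n, j). real n * (F (Y n (j + m n)) - F (Y n j)) / real (m n)) \<longlongrightarrow> 1)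
     (uniformly_along (\<lambda>n. {1..n - m n}))"
proof (rule tendstoI)
  fix e :: real assume e: "0 < e"
  \<comment> \<open>The part \<open>d \<le> 1 / 2\<close> yields the crude bound
    \<open>P \<le> 3 m\<close>; the error is then at most \<open>4 d m\<close>, which
    \<open>d \<le> e / 8\<close> brings below \<open>e m\<close>.\<close>
  define d where "d = min (1 / 2) (e / 8)"
  have d: "0 < d" "d \<le> 1 / 2" "8 * d \<le> e" using e by (auto simp: d_def)
  show "\<forall>\<^sub>F i in uniformly_along (\<lambda>n. {1..n - m n}).
      dist (case i of (n, j) \<Rightarrow> real n * (F (Y n (j + m n)) - F (Y n j)) / real (m n)) 1 < e"
    unfolding eventually_uniformly_along
    using counts[OF d(1)] eventually_gt_at_top[of 0]
  proof eventually_elim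
    case (elim n)
    have m: "0 < real (m n)" using m_bounds[of n] elim by simp
    show ?case
    proof
      fix j assume j: "j \<in> {1..n - m n}"
      define P where "P = real n * (F (Y n (j + m n)) - F (Y n j))"
      have le: "Y n j \<le> Y n (j + m n)" using j by (intro order_stat_mono) auto
      have P0: "0 \<le> P" using F_mono[OF le] by (simp add: P_def)
      have "card {j..j + m n} \<le> card {k \<in> {1..n}. Y n k \<in> {Y n j..Y n (j + m n)}}"
        using j by (intro card_mono) (auto intro!: order_stat_mono)
      then have 1: "real (m n) \<le> sample_count x n {Y n j..Y n (j + m n)}"
        unfolding sample_count_order_stat by simp
      have "k \<in> {j<..<j + m n}" if "k \<in> {1..n}" "Y n k \<in> {Y n j<..<Y n (j + m n)}" for k
        using that j order_stat_mono[of k j n x] order_stat_mono[of "j + m n" k n x]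
        by (cases "j < k"; cases "k < j + m n") force+
      then have "card {k \<in> {1..n}. Y n k \<in> {Y n j<..<Y n (j + m n)}} \<le> card {j<..<j + m n}"
        by (intro card_mono) auto
      then have 2: "sample_count x n {Y n j<..<Y n (j + m n)} \<le> real (m n)"
        unfolding sample_count_order_stat by simp
      have *: "real (m n) \<le> P + d * (real (m n) + P)" "P - d * (real (m n) + P) \<le> real (m n)"
        using 1 2 elim(1)[rule_format, OF le] unfolding P_def by linarith+
      have "P - real (m n) \<le> d * (real (m n) + P)" using *(2) by linarith
      also have "\<dots> \<le> 1 / 2 * (real (m n) + P)"
        using d P0 by (intro mult_right_mono) auto
      finally have "P \<le> 3 * real (m n)" by (simp add: field_simps)
      then have "d * (real (m n) + P) \<le> d * (4 * real (m n))"
        using d by (intro mult_left_mono) auto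
      also have "\<dots> < e * real (m n)"
        using d e m by (simp add: mult.assoc[symmetric])
      finally have "\<bar>P - real (m n)\<bar> < e * real (m n)" using * by linarith
      then have "\<bar>P / real (m n) - 1\<bar> < e"
        using m by (simp add: abs_less_iff field_simps)
      then show "dist (case (n, j) of (n, j) \<Rightarrow> real n * (F (Y n (j + m n)) - F (Y n j)) / real (m n)) 1 < e"
        by (simp add: dist_real_def P_def)
    qed
  qed
qed

text \<open>A spacing carries mass above \<open>m / (2 n)\<close> while \<open>F\<close> has
  Lipschitz constant \<open>B\<close>, so it cannot be too short. In particular its length is
  positive and the default \<open>inverse 0 = 0\<close> does not occur for such
  \<open>n\<close>.\<close>

lemma eventually_spacing_density_bounded:
  "\<forall>\<^sub>F n in sequentially. \<forall>j\<in>{1..n - m n}.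
     0 \<le> spacing_density x n (m n) j \<and> spacing_density x n (m n) j \<le> 2 * B"
proof -
  have "\<forall>\<^sub>F i in uniformly_along (\<lambda>n. {1..n - m n}).
      1 / 2 < (case i of (n, j) \<Rightarrow> real n * (F (Y n (j + m n)) - F (Y n j)) / real (m n))"
    using spacing_mass_tendsto by (rule order_tendstoD) simp
  then show ?thesis
    unfolding eventually_uniformly_along using eventually_gt_at_top[of 0]
  proof eventually_elim
    case (elim n)
    have n: "0 < real n" and m: "0 < real (m n)" using m_bounds[of n] elim by auto
    show ?case
    proof
      fix j assume j: "j \<in> {1..n - m n}"
      have le: "Y n j \<le> Y n (j + m n)" using j by (intro order_stat_mono) auto
      let ?w = "Y n (j + m n) - Y n j"
      have mass: "real (m n) < 2 * real n * (F (Y n (j + m n)) - F (Y n j))"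
        using elim(1) j m by (auto simp: field_simps)
      then have "?w \<noteq> 0" using m by auto
      then have w: "0 < ?w" using le by simp
      have "real (m n) \<le> 2 * real n * (B * ?w)"
        using mass F_lipschitz[OF le] n
        by (intro order_trans[OF less_imp_le[OF mass]] mult_left_mono) auto
      also have "\<dots> \<le> (2 * B) * ((real n + 1) * ?w)"
      proof -
        have "0 \<le> B" using f_nonneg f_le order_trans by blast
        then have "0 \<le> 2 * B * ?w" using w by simp
        then show ?thesis by (simp add: algebra_simps)
      qed
      finally have "real (m n) / ((real n + 1) * ?w) \<le> 2 * B"
        using w n by (subst pos_divide_le_eq) auto
      moreover have "spacing_density x n (m n) j = real (m n) / ((real n + 1) * ?w)"
        by (simp add: spacing_density_def divide_inverse)
      ultimately show "0 \<le> spacing_density x n (m n) j \<and> spacing_density x n (m n) j \<le> 2 * B"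
        using w by simp
    qed
  qed
qed

section \<open>Spacings around a point of differentiability with positive density\<close>

context
  fixes z :: real
  assumes deriv: "(F has_real_derivative f z) (at z)" and pos: "0 < f z"
begin

lemma F_strict: "0 < h \<Longrightarrow> F (z - h) < F z" "0 < h \<Longrightarrow> F z < F (z + h)"
proof -
  assume h: "0 < h"
  obtain d where d: "0 < d" "\<And>h. 0 < h \<Longrightarrow> h < d \<Longrightarrow> F z < F (z + h)"
    using DERIV_pos_inc_right[OF deriv pos] by auto
  have "F z < F (z + min h (d / 2))" using d h by auto
  then show "F z < F (z + h)" using F_mono[of "z + min h (d / 2)" "z + h"] by simp
  obtain d where d: "0 < d" "\<And>h. 0 < h \<Longrightarrow> h < d \<Longrightarrow> F (z - h) < F z"
    using DERIV_pos_inc_left[OF deriv pos] by auto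
  have "F (z - min h (d / 2)) < F z" using d h by auto
  then show "F (z - h) < F z" using F_mono[of "z - h" "z - min h (d / 2)"] by simp
qed

text \<open>There is positive mass on each side of \<open>z\<close> and \<open>m\<close> is
  negligible against \<open>n\<close>, so eventually at least \<open>m\<close> observations lie on
  either side.\<close>

lemma eventually_card_straddling: "\<forall>\<^sub>F n in sequentially. card (J n z) = m n"
proof -
  have "F (- 1) < F z" using F_strict(1)[of 1] F_nonneg[of "z - 1"] F_neg by simp
  then have "\<forall>\<^sub>F n in sequentially. real (m n) \<le> sample_count x n {-1<..<z}"
    by (rule eventually_m_le_sample_count)
  moreover have "\<forall>\<^sub>F n in sequentially. real (m n) \<le> sample_count x n {z<..<z + 1}"
    using F_strict(2)[of 1] by (intro eventually_m_le_sample_count) simp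
  ultimately show ?thesis
  proof eventually_elim
    case (elim n)
    have "sample_count x n {-1<..<z} \<le> sample_count x n {..<z}"
      "sample_count x n {z<..<z + 1} \<le> sample_count x n {z..}"
      by (auto intro!: sample_count_mono)
    then show ?case using elim by (intro card_straddling) linarith+
  qed
qed

lemma mass_tendsto_straddling:
  "((\<lambda>(n, j). real n * (F (Y n (j + m n)) - F (Y n j)) / real (m n)) \<longlongrightarrow> 1)
     (uniformly_along (\<lambda>n. J n z))"
  using spacing_mass_tendsto
  by (rule filterlim_mono) (auto intro!: uniformly_along_mono simp: straddling_def)

text \<open>A straddling spacing that reached as far as \<open>e\<close> from \<open>z\<close> would
  carry at least the mass of \<open>z - e\<close> to \<open>z\<close> or of \<open>z\<close> to
  \<open>z + e\<close>. Both are positive, whereas its mass tends to 0 like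
  \<open>m / n\<close>.\<close>

lemma straddling_endpoints_tendsto:
  "((\<lambda>(n, j). Y n j) \<longlongrightarrow> z) (uniformly_along (\<lambda>n. J n z))"
  "((\<lambda>(n, j). Y n (j + m n)) \<longlongrightarrow> z) (uniformly_along (\<lambda>n. J n z))"
proof -
  let ?G = "uniformly_along (\<lambda>n. J n z)"
  have "((\<lambda>i. real (m (fst i)) / real (fst i)) \<longlongrightarrow> 0) ?G"
    by (rule filterlim_compose[OF m_ratio filterlim_fst_uniformly_along])
  from tendsto_mult[OF mass_tendsto_straddling this]
  have "((\<lambda>i. (case i of (n, j) \<Rightarrow> real n * (F (Y n (j + m n)) - F (Y n j)) / real (m n)) *
      (real (m (fst i)) / real (fst i))) \<longlongrightarrow> 0) ?G"
    by simp
  moreover have "\<forall>\<^sub>F i in ?G. (case i of (n, j) \<Rightarrow> real n * (F (Y n (j + m n)) - F (Y n j)) / real (m n)) *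
      (real (m (fst i)) / real (fst i)) = F (Y (fst i) (snd i + m (fst i))) - F (Y (fst i) (snd i))"
    unfolding eventually_uniformly_along using eventually_gt_at_top[of 0]
  proof eventually_elim
    case (elim n)
    then show ?case using m_bounds[of n] by auto
  qed
  ultimately have "((\<lambda>i. F (Y (fst i) (snd i + m (fst i))) - F (Y (fst i) (snd i))) \<longlongrightarrow> 0) ?G"
    by (rule Lim_transform_eventually)
  then have small: "\<forall>\<^sub>F n in sequentially. \<forall>j\<in>J n z. F (Y n (j + m n)) - F (Y n j) < d" if "0 < d" for d
    using order_tendstoD(2)[OF _ that] by (fastforce simp: eventually_uniformly_along)
  have near: "\<forall>\<^sub>F n in sequentially. \<forall>j\<in>J n z. \<bar>Y n j - z\<bar> < e \<and> \<bar>Y n (j + m n) - z\<bar> < e" if e: "0 < e" for e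
    using small[of "min (F z - F (z - e)) (F (z + e) - F z)", simplified, OF conjI[OF F_strict[OF e]]]
  proof eventually_elim
    case (elim n)
    show ?case
    proof
      fix j assume j: "j \<in> J n z"
      then have a: "Y n j < z" "z \<le> Y n (j + m n)" by (auto simp: straddling_def)
      have "F (z - e) < F (Y n j)" "F (Y n (j + m n)) < F (z + e)"
        using elim j a F_mono[of "Y n j" z] F_mono[of z "Y n (j + m n)"] by force+
      then have "z - e < Y n j" "Y n (j + m n) < z + e"
        using F_mono[of "Y n j" "z - e"] F_mono[of "z + e" "Y n (j + m n)"] by force+
      then show "\<bar>Y n j - z\<bar> < e \<and> \<bar>Y n (j + m n) - z\<bar> < e" using a by simp
    qed
  qed
  show "((\<lambda>(n, j). Y n j) \<longlongrightarrow> z) ?G" "((\<lambda>(n, j). Y n (j + m n)) \<longlongrightarrow> z) ?G"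
    by (rule tendstoI, unfold eventually_uniformly_along, drule near,
        erule eventually_mono, simp add: dist_real_def)+
qed

text \<open>The spacing density is the difference quotient of \<open>F\<close> over the spacing,
  multiplied by \<open>n / (n + 1)\<close> and divided by \<open>n / m\<close> times the mass of the
  spacing; both corrections tend to 1.\<close>

lemma spacing_density_tendsto:
  "((\<lambda>(n, j). spacing_density x n (m n) j) \<longlongrightarrow> f z) (uniformly_along (\<lambda>n. J n z))"
proof -
  let ?G = "uniformly_along (\<lambda>n. J n z)"
  let ?P = "\<lambda>i. (case i of (n, j) \<Rightarrow> real n * (F (Y n (j + m n)) - F (Y n j)) / real (m n))"
  let ?q = "\<lambda>i. (F (case i of (n, j) \<Rightarrow> Y n (j + m n)) - F (case i of (n, j) \<Rightarrow> Y n j)) /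
     ((case i of (n, j) \<Rightarrow> Y n (j + m n)) - (case i of (n, j) \<Rightarrow> Y n j))"
  have q: "(?q \<longlongrightarrow> f z) ?G"
    by (intro tendsto_straddled_difference_quotient[OF deriv] straddling_endpoints_tendsto)
       (auto simp: eventually_uniformly_along straddling_def)
  have n: "((\<lambda>i. real (fst i) / (real (fst i) + 1)) \<longlongrightarrow> 1) ?G"
    by (rule filterlim_compose[OF LIMSEQ_n_over_Suc_n[unfolded of_nat_Suc add.commute[of 1]] filterlim_fst_uniformly_along])
  have "((\<lambda>i. inverse (?P i) * (real (fst i) / (real (fst i) + 1)) * ?q i) \<longlongrightarrow> inverse 1 * 1 * f z) ?G"
    by (intro tendsto_mult tendsto_inverse mass_tendsto_straddling n q) simp
  moreover have "\<forall>\<^sub>F i in ?G. inverse (?P i) * (real (fst i) / (real (fst i) + 1)) * ?q i =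
      (case i of (n, j) \<Rightarrow> spacing_density x n (m n) j)"
    using order_tendstoD(1)[OF mass_tendsto_straddling zero_less_one]
  proof eventually_elim
    case (elim i)
    obtain n j where i: "i = (n, j)" by fastforce
    have P: "0 < real n * (F (Y n (j + m n)) - F (Y n j)) / real (m n)" using elim by (simp add: i)
    have "real n \<noteq> 0" "real (m n) \<noteq> 0" "F (Y n (j + m n)) - F (Y n j) \<noteq> 0"
      by (rule contrapos_pn[OF P], simp)+
    \<comment> \<open>The rearrangement is valid even for zero arguments because
      \<open>inverse\<close> distributes over products; \<open>N / N\<close> and
      \<open>D / D\<close> cancel afterwards, by positivity of \<open>?P\<close>.\<close>
    moreover have split: "inverse (N * D / M) * (N / (N + 1)) * (D / w) = N / N * (D / D) * (M / (N + 1) * inverse w)"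
      for N D M w :: real
      by (simp only: divide_inverse inverse_mult_distrib inverse_inverse_eq mult_ac)
    ultimately show ?case unfolding i prod.case fst_conv split by (simp add: spacing_density_def)
  qed
  ultimately show ?thesis by (simp add: tendsto_cong)
qed

end

text \<open>Sum and integral are interchanged: rank \<open>j\<close> contributes at \<open>z\<close>
  exactly when \<open>z\<close> lies in its half-open spacing, over which \<open>f\<close>
  integrates to an increment of \<open>F\<close>.\<close>

lemma spacing_sum_eq_integral:
  shows "integrable lborel (\<lambda>z. f z * ((\<Sum>j\<in>J n z. a j) / real (m n)))" (is ?int)
    and "(\<integral>z. f z * ((\<Sum>j\<in>J n z. a j) / real (m n)) \<partial>lborel) =
      (\<Sum>j=1..n - m n. a j * (F (Y n (j + m n)) - F (Y n j))) / real (m n)" (is ?eq)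
proof -
  have sum: "f z * ((\<Sum>j\<in>J n z. a j) / real (m n)) =
      (\<Sum>j=1..n - m n. a j / real (m n) * (f z * indicator {Y n j<..Y n (j + m n)} z))" for z
  proof -
    have eq: "(\<Sum>j\<in>J n z. a j) = (\<Sum>j=1..n - m n. a j * indicator {Y n j<..Y n (j + m n)} z)"
      unfolding straddling_def sum.inter_filter[OF finite_atLeastAtMost]
      by (intro sum.cong) (auto simp: indicator_def)
    show ?thesis unfolding eq sum_divide_distrib sum_distrib_left by (intro sum.cong) simp_all
  qed
  have int: "integrable lborel (\<lambda>z. f z * indicator {Y n j<..Y n (j + m n)} z)" for j
    using f_integrable by (intro integrable_real_mult_indicator) auto
  show ?int unfolding sum
    by (intro Bochner_Integration.integrable_sum Bochner_Integration.integrable_mult_right int)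
  have "(\<integral>z. f z * ((\<Sum>j\<in>J n z. a j) / real (m n)) \<partial>lborel) =
     (\<Sum>j=1..n - m n. a j / real (m n) * (\<integral>z. f z * indicator {Y n j<..Y n (j + m n)} z \<partial>lborel))"
    unfolding sum
    by (subst Bochner_Integration.integral_sum)
       (auto intro!: Bochner_Integration.integrable_mult_right int)
  also have "\<dots> = (\<Sum>j=1..n - m n. a j / real (m n) * (F (Y n (j + m n)) - F (Y n j)))"
    by (intro sum.cong refl, subst F_diff_halfopen) (auto intro!: order_stat_mono)
  finally show ?eq by (simp add: sum_divide_distrib)
qed

text \<open>Eventually the sum has exactly \<open>m\<close> terms, so it is a true average of values
  uniformly close to \<open>h\<close>.\<close>

lemma average_straddling_tendsto:
  assumes z: "(F has_real_derivative f z) (at z)" "0 < f z"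
    and a: "((\<lambda>(n, j). a n j) \<longlongrightarrow> h) (uniformly_along (\<lambda>n. J n z))"
  shows "(\<lambda>n. (\<Sum>j\<in>J n z. a n j) / real (m n)) \<longlonglongrightarrow> h"
proof (rule tendstoI)
  fix e :: real assume e: "0 < e"
  have "\<forall>\<^sub>F n in sequentially. \<forall>j\<in>J n z. dist (a n j) h < e / 2"
    using tendstoD[OF a half_gt_zero[OF e]] by (simp add: eventually_uniformly_along)
  then show "\<forall>\<^sub>F n in sequentially. dist ((\<Sum>j\<in>J n z. a n j) / real (m n)) h < e"
    using eventually_card_straddling[OF z] eventually_gt_at_top[of 0]
  proof eventually_elim
    case (elim n)
    have m: "0 < real (m n)" using m_bounds[of n] elim by simp
    have "\<bar>(\<Sum>j\<in>J n z. a n j) - real (m n) * h\<bar> = \<bar>\<Sum>j\<in>J n z. a n j - h\<bar>"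
      using elim by (simp add: sum_subtractf)
    also have "\<dots> \<le> (\<Sum>j\<in>J n z. \<bar>a n j - h\<bar>)" by (rule sum_abs)
    also have "\<dots> \<le> (\<Sum>j\<in>J n z. e / 2)"
      using elim by (intro sum_mono) (auto simp: dist_real_def less_imp_le)
    also have "\<dots> < e * real (m n)" using elim e m by simp
    finally show ?case using m by (simp add: dist_real_def abs_less_iff field_simps)
  qed
qed

text \<open>Since every spacing carries mass about \<open>m / n\<close>, the average of the \<open>a n j\<close> over the ranks is,
  up to a factor tending to 1, the integral of \<open>f z\<close> times the average of \<open>a n j\<close> over the \<open>m\<close> ranks
  straddling \<open>z\<close>.\<close>

lemma rank_average_tendsto:
  assumes C: "0 \<le> C"
    and bounded: "\<forall>\<^sub>F n in sequentially. \<forall>j\<in>{1..n - m n}. 0 \<le> a n j \<and> a n j \<le> C"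
    and h [measurable]: "h \<in> borel_measurable borel"
    and conv: "AE z in lborel. (F has_real_derivative f z) (at z) \<longrightarrow> 0 < f z \<longrightarrow>
      ((\<lambda>(n, j). a n j) \<longlongrightarrow> h z) (uniformly_along (\<lambda>n. J n z))"
  shows "(\<lambda>n. (\<Sum>j=1..n - m n. a n j) / (real n - real (m n))) \<longlonglongrightarrow> (\<integral>z. f z * h z \<partial>lborel)"
proof -
  define ok where "ok = (\<lambda>n. 1 \<le> n \<and> (\<forall>j\<in>{1..n - m n}. 0 \<le> a n j \<and> a n j \<le> C))"
  have ev_ok: "\<forall>\<^sub>F n in sequentially. ok n"
    using bounded eventually_ge_at_top[of 1] by eventually_elim (simp add: ok_def)
  \<comment> \<open>Setting \<open>H\<close> to 0 at the finitely many \<open>n\<close> without the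
    bound makes one dominating function valid for every \<open>n\<close>.\<close>
  define H where "H = (\<lambda>n z. if ok n then f z * ((\<Sum>j\<in>J n z. a n j) / real (m n)) else 0)"
  have [measurable]: "H n \<in> borel_measurable lborel" for n
  proof (cases "ok n")
    case True
    then show ?thesis
      using borel_measurable_integrable[OF spacing_sum_eq_integral(1)[where n = n and a = "a n"]]
      by (simp add: H_def ok_def)
  qed (simp add: H_def)
  have lim: "(\<lambda>n. \<integral>z. H n z \<partial>lborel) \<longlonglongrightarrow> (\<integral>z. f z * h z \<partial>lborel)"
  proof (rule integral_dominated_convergence[where w = "\<lambda>z. C * f z"])
    show "AE z in lborel. (\<lambda>n. H n z) \<longlonglongrightarrow> f z * h z"
      using conv AE_F_derivative
    proof eventually_elim
      case (elim z)
      show ?case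
      proof (cases "f z = 0")
        case True
        then have "H n z = 0" for n by (simp add: H_def)
        then show ?thesis using True by simp
      next
        case False
        then have fz: "0 < f z" using f_nonneg[of z] by simp
        have "(\<lambda>n. f z * ((\<Sum>j\<in>J n z. a n j) / real (m n))) \<longlonglongrightarrow> f z * h z"
          using elim fz by (intro tendsto_mult_left average_straddling_tendsto) auto
        then show ?thesis
          by (rule Lim_transform_eventually) (use ev_ok in \<open>auto simp: H_def elim: eventually_mono\<close>)
      qed
    qed
    show "AE z in lborel. norm (H n z) \<le> C * f z" for n
    proof (rule AE_I2)
      fix z
      show "norm (H n z) \<le> C * f z"
      proof (cases "ok n")
        case True
        then have m: "0 < real (m n)" using m_bounds[of n] by (auto simp: ok_def)
        have ab: "0 \<le> a n j" "a n j \<le> C" if "j \<in> J n z" for j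
          using True that by (auto simp: ok_def straddling_def)
        have "(\<Sum>j\<in>J n z. a n j) \<le> real (card (J n z)) * C"
          using ab by (intro sum_bounded_above) auto
        also have "\<dots> \<le> real (m n) * C"
          using C card_straddling_le by (intro mult_right_mono) auto
        finally have "(\<Sum>j\<in>J n z. a n j) / real (m n) \<le> C" using m by (simp add: field_simps)
        moreover have "0 \<le> (\<Sum>j\<in>J n z. a n j) / real (m n)"
          using ab by (intro divide_nonneg_nonneg sum_nonneg) auto
        moreover have "H n z = f z * ((\<Sum>j\<in>J n z. a n j) / real (m n))" using True by (simp add: H_def)
        ultimately show ?thesis
          using f_nonneg[of z] by (metis abs_of_nonneg mult.commute mult_left_mono mult_nonneg_nonneg real_norm_def)
      qed (use C f_nonneg in \<open>simp add: H_def\<close>)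
    qed
  qed (use f_integrable in auto)
  have ratio: "(\<lambda>n. real n / (real n - real (m n))) \<longlonglongrightarrow> 1"
  proof -
    have "(\<lambda>n. 1 / (1 - real (m n) / real n)) \<longlonglongrightarrow> 1 / (1 - 0)"
      by (intro tendsto_divide tendsto_diff tendsto_const m_ratio) simp
    moreover have "\<forall>\<^sub>F n in sequentially. 1 / (1 - real (m n) / real n) = real n / (real n - real (m n))"
      using eventually_gt_at_top[of 0] by eventually_elim (simp add: field_simps)
    ultimately show ?thesis by (simp add: tendsto_cong)
  qed
  let ?W = "\<lambda>n. (\<Sum>j=1..n - m n. a n j) / (real n - real (m n))"
  \<comment> \<open>For all large \<open>n\<close>, \<open>?I n\<close> is the average
    \<open>?W n\<close> with each \<open>a n j\<close> weighted by the normalized mass of its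
    spacing; these weights tend to 1 uniformly.\<close>
  let ?I = "\<lambda>n. real n / (real n - real (m n)) * (\<integral>z. H n z \<partial>lborel)"
  have "(\<lambda>n. ?W n - ?I n) \<longlonglongrightarrow> 0"
  proof (rule tendstoI)
    fix e :: real assume e: "0 < e"
    \<comment> \<open>Adding 1 covers \<open>C = 0\<close> and makes \<open>C * d < e\<close>
      strict.\<close>
    define d where "d = e / (C + 1)"
    have d: "0 < d" "C * d < e" using C e by (auto simp: d_def field_simps)
    have "\<forall>\<^sub>F n in sequentially. \<forall>j\<in>{1..n - m n}.
       \<bar>real n * (F (Y n (j + m n)) - F (Y n j)) / real (m n) - 1\<bar> < d"
      using tendstoD[OF spacing_mass_tendsto d(1)]
      by (simp add: eventually_uniformly_along dist_real_def)
    then show "\<forall>\<^sub>F n in sequentially. dist (?W n - ?I n) 0 < e"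
      using ev_ok eventually_m_less
    proof eventually_elim
      case (elim n)
      let ?P = "\<lambda>j. real n * (F (Y n (j + m n)) - F (Y n j)) / real (m n)"
      have nm: "0 < real n - real (m n)" using elim by simp
      have "(\<integral>z. H n z \<partial>lborel) =
          (\<Sum>j=1..n - m n. a n j * (F (Y n (j + m n)) - F (Y n j))) / real (m n)"
        using elim spacing_sum_eq_integral(2)[where n = n and a = "a n"] by (simp add: H_def ok_def)
      moreover have "(\<Sum>j=1..n - m n. a n j * (1 - ?P j)) = (\<Sum>j=1..n - m n. a n j) -
          real n * ((\<Sum>j=1..n - m n. a n j * (F (Y n (j + m n)) - F (Y n j))) / real (m n))"
        unfolding sum_divide_distrib sum_distrib_left sum_subtractf[symmetric]
        by (intro sum.cong) (simp_all add: right_diff_distrib mult.left_commute)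
      ultimately have "?W n - ?I n = (\<Sum>j=1..n - m n. a n j * (1 - ?P j)) / (real n - real (m n))"
        by (simp only: diff_divide_distrib times_divide_eq_left)
      moreover have "\<bar>\<Sum>j=1..n - m n. a n j * (1 - ?P j)\<bar> < (real n - real (m n)) * e"
      proof -
        have "\<bar>\<Sum>j=1..n - m n. a n j * (1 - ?P j)\<bar> \<le> (\<Sum>j=1..n - m n. \<bar>a n j * (1 - ?P j)\<bar>)"
          by (rule sum_abs)
        also have "\<dots> \<le> (\<Sum>j=1..n - m n. C * d)"
        proof (rule sum_mono)
          fix j assume j: "j \<in> {1..n - m n}"
          have "0 \<le> a n j" "a n j \<le> C" using elim(2) j by (auto simp: ok_def)
          moreover have "\<bar>1 - ?P j\<bar> \<le> d" using elim(1) j by (force simp: abs_minus_commute)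
          ultimately show "\<bar>a n j * (1 - ?P j)\<bar> \<le> C * d"
            unfolding abs_mult using C by (intro mult_mono) auto
        qed
        also have "\<dots> = (real n - real (m n)) * (C * d)"
          using elim by (simp add: of_nat_diff)
        also have "\<dots> < (real n - real (m n)) * e"
          using nm d by (intro mult_strict_left_mono) auto
        finally show ?thesis .
      qed
      ultimately show ?case
        using nm by (simp add: dist_real_def divide_less_eq mult.commute)
    qed
  qed
  from tendsto_add[OF this tendsto_mult[OF ratio lim]] show ?thesis by simp
qed

text \<open>The cases \<open>k = 2\<close> and \<open>k = 1\<close> are the averages in
  \<open>T_est\<close> and \<open>T'_est\<close>. Both ends of a spacing tend to \<open>z\<close>,
  so the two indicators give twice the one at \<open>z\<close>, offset by the factor 1/2. The extra
  power of \<open>f\<close> arises because ranks are spread according to the density.\<close>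

lemma spacing_average_tendsto:
  "(\<lambda>n. 1 / (2 * (real n - real (m n))) *
     (\<Sum>j=1..n - m n. spacing_density x n (m n) j ^ k *
        (indicator {t1..t2} (Y n j) + indicator {t1..t2} (Y n (j + m n)))))
    \<longlonglongrightarrow> (LBINT z:{t1..t2}. f z ^ Suc k)"
proof -
  let ?ind = "indicat_real {t1..t2}"
  let ?a = "\<lambda>n j. spacing_density x n (m n) j ^ k * (?ind (Y n j) + ?ind (Y n (j + m n)))"
  have B: "0 \<le> B" using f_nonneg f_le order_trans by blast
  have "(\<lambda>n. (\<Sum>j=1..n - m n. ?a n j) / (real n - real (m n)))
      \<longlonglongrightarrow> (\<integral>z. f z * (f z ^ k * (?ind z + ?ind z)) \<partial>lborel)"
  proof (rule rank_average_tendsto[where C = "(2 * B) ^ k * 2"])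
    show "\<forall>\<^sub>F n in sequentially. \<forall>j\<in>{1..n - m n}. 0 \<le> ?a n j \<and> ?a n j \<le> (2 * B) ^ k * 2"
      using eventually_spacing_density_bounded
    proof eventually_elim
      case (elim n)
      show ?case
      proof
        fix j assume "j \<in> {1..n - m n}"
        then have s: "0 \<le> spacing_density x n (m n) j" "spacing_density x n (m n) j \<le> 2 * B"
          using elim by auto
        have "?ind (Y n j) + ?ind (Y n (j + m n)) \<le> 2" by (auto simp: indicator_def)
        with s B show "0 \<le> ?a n j \<and> ?a n j \<le> (2 * B) ^ k * 2"
          by (intro conjI mult_nonneg_nonneg mult_mono power_mono) auto
      qed
    qed
    show "AE z in lborel. (F has_real_derivative f z) (at z) \<longrightarrow> 0 < f z \<longrightarrow>
      ((\<lambda>(n, j). ?a n j) \<longlongrightarrow> f z ^ k * (?ind z + ?ind z)) (uniformly_along (\<lambda>n. J n z))"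
      using AE_lborel_singleton[of t1] AE_lborel_singleton[of t2]
    proof eventually_elim
      case (elim z)
      show ?case
      proof (intro impI)
        assume z: "(F has_real_derivative f z) (at z)" "0 < f z"
        \<comment> \<open>The indicator is discontinuous only at \<open>t1\<close> and
          \<open>t2\<close>, which form a null set.\<close>
        have "z \<notin> frontier {t1..t2}"
          using elim by (cases "t1 \<le> t2") (auto simp: frontier_def interior_atLeastAtMost_real)
        then have cont: "isCont ?ind z" by (simp add: isCont_indicator)
        have "((\<lambda>i. (case i of (n, j) \<Rightarrow> spacing_density x n (m n) j) ^ k *
            (?ind (case i of (n, j) \<Rightarrow> Y n j) + ?ind (case i of (n, j) \<Rightarrow> Y n (j + m n))))
            \<longlongrightarrow> f z ^ k * (?ind z + ?ind z)) (uniformly_along (\<lambda>n. J n z))"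
          by (intro tendsto_mult tendsto_power tendsto_add spacing_density_tendsto
              isCont_tendsto_compose[OF cont] straddling_endpoints_tendsto z)
        then show "((\<lambda>(n, j). ?a n j) \<longlongrightarrow> f z ^ k * (?ind z + ?ind z)) (uniformly_along (\<lambda>n. J n z))"
          by (simp add: case_prod_unfold)
      qed
    qed
  qed (use B in simp_all)
  from tendsto_mult_left[OF this, of "1 / 2"]
  have "(\<lambda>n. 1 / (2 * (real n - real (m n))) * (\<Sum>j=1..n - m n. ?a n j))
      \<longlonglongrightarrow> 1 / 2 * (\<integral>z. f z * (f z ^ k * (?ind z + ?ind z)) \<partial>lborel)"
    by (simp add: field_simps)
  moreover have "(\<integral>z. f z * (f z ^ k * (?ind z + ?ind z)) \<partial>lborel) = 2 * (LBINT z:{t1..t2}. f z ^ Suc k)"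
    unfolding set_lebesgue_integral_def integral_mult_right_zero[symmetric]
    by (intro Bochner_Integration.integral_cong) (auto simp: indicator_def)
  ultimately show ?thesis by simp
qed

lemma IV_est_tendsto:
  assumes t: "0 \<le> t1" "0 \<le> t2" and F: "F t1 < F t2"
  shows "(\<lambda>n. IV_est x n (m n) t1 t2) \<longlonglongrightarrow> interval_varextropy f F t1 t2"
proof -
  have 2: "(\<lambda>n. T_est x n (m n) t1 t2) \<longlonglongrightarrow> (LBINT z:{t1..t2}. f z ^ 3)"
    using spacing_average_tendsto[of 2 t1 t2] by (simp add: T_est_def eval_nat_numeral)
  have 1: "(\<lambda>n. T'_est x n (m n) t1 t2) \<longlonglongrightarrow> (LBINT z:{t1..t2}. f z ^ 2)\<^sup>2"
    unfolding T'_est_def using spacing_average_tendsto[of 1 t1 t2]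
    by (intro tendsto_power) (simp add: eval_nat_numeral)
  show ?thesis
    unfolding IV_est_def interval_varextropy_def
    by (intro tendsto_diff tendsto_mult tendsto_divide tendsto_const tendsto_power 1 2
        emp_cdf_tendsto t) (use F in auto)
qed

end

section \<open>Almost every realization is a regular sample\<close>

theorem theorem6:
  fixes M :: "'a measure"
    and X :: "nat \<Rightarrow> 'a \<Rightarrow> real"
    and f F :: "real \<Rightarrow> real"
    and m :: "nat \<Rightarrow> nat"
    and t1 t2 :: real
  assumes "prob_space M"
    and "prob_space.indep_vars M (\<lambda>_. borel) X UNIV"
    and "\<And>i. distributed M lborel (X i) (\<lambda>x. ennreal (f x))"
    and "\<And>i. AE \<omega> in M. 0 \<le> X i \<omega>"
    and "\<And>x. 0 \<le> f x"
    and "bounded (range f)"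
    and "\<And>t. F t = cdf (distr M borel (X 0)) t"
    and "\<And>n. 1 \<le> n \<Longrightarrow> 1 \<le> m n \<and> m n \<le> n"
    and "filterlim m at_top sequentially"
    and "filterlim (\<lambda>n. real (m n) / ln (real n)) at_top sequentially"
    and "(\<lambda>n. real (m n) / real n) \<longlonglongrightarrow> 0"
    and "0 < t1" and "t1 < t2"
    and "F t1 < F t2"
  shows "AE \<omega> in M. (\<lambda>n. \<bar>IV_est (\<lambda>i. X i \<omega>) n (m n) t1 t2
                            - interval_varextropy f F t1 t2\<bar>) \<longlonglongrightarrow> 0"
proof -
  interpret prob_space M by fact
  define \<mu> where "\<mu> = density lborel (\<lambda>x. ennreal (f x))"
  have rv [measurable]: "X i \<in> borel_measurable M" for i
    using assms(2) by (simp add: indep_vars_def)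
  have distr: "distr M borel (X i) = \<mu>" for i
    using distributed_distr_eq_density[OF assms(3)[of i]]
    by (simp add: \<mu>_def cong: distr_cong)
  have \<mu>: "real_distribution \<mu>"
    unfolding distr[of 0, symmetric] by (rule real_distribution_distr) measurable
  interpret \<mu>: real_distribution \<mu> by (rule \<mu>)
  have F: "F = cdf \<mu>" using assms(7) distr by auto
  \<comment> \<open>The predicate \<open>distributed\<close> gives measurability of the
    \<open>ennreal\<close> version; nonnegativity recovers \<open>f\<close> from it.\<close>
  have "(\<lambda>x. enn2real (ennreal (f x))) \<in> borel_measurable lborel"
    using distributed_borel_measurable[OF assms(3)[of 0]] by measurable
  then have f [measurable]: "f \<in> borel_measurable lborel" by (simp add: assms(5))
  obtain B where B: "f z \<le> B" for z
    using assms(6) unfolding bounded_iff by (force simp: abs_le_iff)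
  have "(\<integral>\<^sup>+z. ennreal (f z) \<partial>lborel) = 1"
    using \<mu>.emeasure_space_1 by (simp add: \<mu>_def emeasure_density)
  then have f_int: "integrable lborel f"
    using assms(5) by (intro integrableI_nonneg) auto
  have f_set_int: "set_integrable lborel A f" if "A \<in> sets borel" for A
    using f_int that unfolding set_integrable_def by (intro integrable_mult_indicator) auto
  have meas: "measure \<mu> A = (LBINT z:A. f z)" if A: "A \<in> sets borel" for A
  proof -
    have "emeasure \<mu> A = (\<integral>\<^sup>+z. ennreal (indicator A z *\<^sub>R f z) \<partial>lborel)"
      unfolding \<mu>_def using A
      by (subst emeasure_density) (auto intro!: nn_integral_cong split: split_indicator)
    also have "\<dots> = ennreal (LBINT z:A. f z)"
      unfolding set_lebesgue_integral_def
      using f_set_int[OF A] assms(5) by (intro nn_integral_eq_integral) (auto simp: set_integrable_def)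
    finally show ?thesis
      using assms(5) by (simp add: measure_def set_lebesgue_integral_def)
  qed
  have diffuse: "measure \<mu> {z} = 0" for z
  proof -
    have "AE y in lborel. indicat_real {z} y *\<^sub>R f y = 0"
      using AE_lborel_singleton[of z] by eventually_elim auto
    then show ?thesis by (simp add: meas set_lebesgue_integral_def integral_eq_zero_AE)
  qed
  \<comment> \<open>The cdf increment is the mass of a half-open interval; closing it adds only the
    atom at \<open>a\<close>, which is null.\<close>
  have F_diff: "F b - F a = (LBINT z:{a..b}. f z)" if "a \<le> b" for a b
  proof -
    have "{..b} = {..a} \<union> {a<..b}" "{a..b} = {a} \<union> {a<..b}" using that by auto
    moreover have "measure \<mu> ({..a} \<union> {a<..b}) = measure \<mu> {..a} + measure \<mu> {a<..b}"
      "measure \<mu> ({a} \<union> {a<..b}) = measure \<mu> {a} + measure \<mu> {a<..b}"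
      by (intro \<mu>.finite_measure_Union; simp add: disjoint_iff)+
    ultimately have "measure \<mu> {..b} = measure \<mu> {..a} + measure \<mu> {a<..b}"
      "measure \<mu> {a..b} = measure \<mu> {a} + measure \<mu> {a<..b}"
      by (simp_all only:)
    then show ?thesis by (simp add: F cdf_def2 diffuse meas[symmetric])
  qed
  have "AE \<omega> in M. X 0 \<omega> \<notin> {..-1}"
    using assms(4)[of 0] by eventually_elim auto
  then have "prob (X 0 -` {..-1} \<inter> space M) = 0"
    by (subst prob_eq_0) auto
  then have F_neg: "F (- 1) = 0"
    unfolding F cdf_def2 distr[of 0, symmetric] by (subst measure_distr) auto
  have "AE \<omega> in M. \<forall>i. 0 \<le> X i \<omega>"
    using assms(4) by (simp add: AE_all_countable)
  then show ?thesis
    using AE_uniform_interval_counts[OF assms(1,2) distr diffuse assms(9,10)]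
  proof eventually_elim
    case (elim \<omega>)
    interpret regular_sample "\<lambda>i. X i \<omega>" f F m B
    proof
      show "(\<lambda>n. real (m n) / real n) \<longlonglongrightarrow> 0" by fact
      show "1 \<le> n \<Longrightarrow> 1 \<le> m n \<and> m n \<le> n" for n by fact
    qed (use elim assms(5) B f_int F_diff F_neg \<mu>.cdf_nonneg \<mu>.cdf_bounded_prob in \<open>auto simp: F\<close>)
    have "(\<lambda>n. IV_est (\<lambda>i. X i \<omega>) n (m n) t1 t2) \<longlonglongrightarrow> interval_varextropy f F t1 t2"
      using assms(12-14) by (intro IV_est_tendsto) auto
    then show ?case by (simp add: LIM_zero tendsto_rabs_zero)
  qed
qed

end
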